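(* Let $0\le\ell(x,\xi)\le\ell^\infty(x):=\sup_{\xi\in\Sigma}\ell(x,\xi)$, let $f^\star$ be an upper semicontinuous function, let $d$ be a lower semicontinuous function with $d(\xi,\xi)=0$ for all $\xi\in\Sigma$, and let $\ell(x,\xi)$ be an upper semicontinuous function in $\xi\in\Sigma$ for all $x\in X$. Then for every integer $K\ge1$ and $r>0$, $$\hat c^{\epsilon,K}_{f,d,r}(x,\hat P)\le\hat c^{\epsilon}_{f,d,r}(x,\hat P)\le\left(\left(\frac{\mathrm{diam}(\Sigma)}{\epsilon}\right)^{1/K}+\frac1K\right)\hat c^{\epsilon,K}_{f,d,r}(x,\hat P)$$ for all $x\in X$, $\hat P\in\mathcal{P}(\Sigma)$ and $\epsilon\in(0,\mathrm{diam}(\Sigma)]$.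
   Context: $\Sigma\subset\mathbb{R}^n$ is compact, $\|\cdot\|$ is the Euclidean norm on $\mathbb{R}^n$, $X\subseteq\mathbb{R}^m$ is the set of decisions, $\ell:X\times\Sigma\to\mathbb{R}$ is the loss, $\mathcal{P}(\Sigma)$ is the set of Borel probability measures on $\Sigma$. $f$-divergence: $f:[0,\infty)\to\mathbb{R}\cup\{+\infty\}$ is convex, lower semicontinuous, finite on $(0,\infty)$, $f(1)=0$; $f^\infty:=\lim_{u\to\infty}f(u)/u\in\mathbb{R}\cup\{+\infty\}$. $D_f(P',P):=\int f\left(\frac{\mathrm{d}P_c}{\mathrm{d}P'}\right)\mathrm{d}P'+f^\infty P_s(\Sigma)$, where $P=P_c+P_s$ is the Lebesgue decomposition with $P_c\ll P'$, $P_s\perp P'$ (and $0\cdot\infty=0$). $f^\star(s):=\sup_{t\ge0}\{st-f(t)\}$. For $\lambda\ge0$, $\lambda f^\star(a/\lambda):=\sup_{t\ge0}\{at-\lambda f(t)\}$ (for $\lambda=0$: $0$ if $a\le0$, $+\infty$ if $a>0$). If $f^\infty=+\infty$, the constraint involving $f^\infty\lambda$ is understood as void. Transport: $d:\Sigma\times\Sigma\to\mathbb{R}_+$ is the transport cost; $W_d(P',P)=\inf\{\int d(\xi',\xi)\,\mathrm{d}\gamma(\xi',\xi):\gamma\in\Gamma(P',P)\}$ with $\Gamma(P',P)$ the set of couplings of $P'$ and $P$. $\mathrm{diam}(\Sigma):=\sup_{\xi,\xi'\in\Sigma}\|\xi-\xi'\|$. $\ell^\delta(x,\xi):=\sup\{\ell(x,\xi'):\xi'\in\Sigma,\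 d(\xi,\xi')\le\delta\}$. For $\epsilon\in(0,\mathrm{diam}(\Sigma)]$, $$\Delta_K:=\{\epsilon k/K:k=0,\dots,K\}\cup\{\epsilon(\mathrm{diam}(\Sigma)/\epsilon)^{k/K}:k=0,\dots,K\}.$$ Predictor: $D^{\epsilon}_{f,d}(P',P)=\inf\{D_f(Q,P):Q\in\mathcal{P}(\Sigma),\ W_d(P',Q)\le\epsilon\}$, $\hat c^{\epsilon}_{f,d,r}(x,\hat P)=\sup\{\int\ell(x,\xi)\,\mathrm{d}P(\xi):P\in\mathcal{P}(\Sigma),\ D^{\epsilon}_{f,d}(\hat P,P)\le r\}$. Discretized approximation: $$\hat c^{\epsilon,K}_{f,d,r}(x,\hat P):=\inf\left\{\int\left[\sup_{\delta\in\Delta_K}\lambda f^\star\!\left(\frac{\ell^\delta(x,\xi)-\eta}{\lambda}\right)-\delta\gamma\right]\mathrm{d}\hat P(\xi)+r\lambda+\eta+\epsilon\gamma:\ \eta\in\mathbb{R},\ \lambda,\gamma\in\mathbb{R}_+,\ \ell^\infty(x)-\eta\le f^\infty\lambda\right\}.$$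
   Formalization: The second inequality is proved under the extra assumption d(ξ,ξ') ≤ diam(Σ) on Σ×Σ, without which it is false (e.g. Σ={0,1}, d(0,1)=100, ε=1); the first inequality holds as stated. *)

theory Defs
  imports "HOL-Probability.Probability"
begin

definition lsc_on :: "'a::topological_space set \<Rightarrow> ('a \<Rightarrow> 'b::linorder) \<Rightarrow> bool" where
  "lsc_on A g \<longleftrightarrow> (\<forall>x\<in>A. \<forall>c. c < g x \<longrightarrow> (\<forall>\<^sub>F y in at x within A. c < g y))"

definition usc_on :: "'a::topological_space set \<Rightarrow> ('a \<Rightarrow> 'b::linorder) \<Rightarrow> bool" where
  "usc_on A g \<longleftrightarrow> (\<forall>x\<in>A. \<forall>c. g x < c \<longrightarrow> (\<forall>\<^sub>F y in at x within A. g y < c))"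

text \<open>Integral of an extended-real-valued function.  All integrands below have an integrable
  negative part, so the ill-defined difference of two infinities never arises.\<close>

definition eintegral :: "'a measure \<Rightarrow> ('a \<Rightarrow> ereal) \<Rightarrow> ereal" where
  "eintegral M g =
     enn2ereal (\<integral>\<^sup>+x. e2ennreal (g x) \<partial>M) - enn2ereal (\<integral>\<^sup>+x. e2ennreal (- g x) \<partial>M)"

definition borel_probs :: "'a::topological_space set \<Rightarrow> 'a measure set" where
  "borel_probs S = {P. sets P = sets (restrict_space borel S) \<and> prob_space P}"

text \<open>Generators of divergences; only the values on \<open>[0, \<infinity>)\<close> matter.\<close>

definition divergence_generator :: "(real \<Rightarrow> ereal) \<Rightarrow> bool" where
  "divergence_generator f \<longleftrightarrow>
     (\<forall>t\<ge>0. f t \<noteq> -\<infinity>) \<and> (\<forall>t>0. \<bar>f t\<bar> \<noteq> \<infinity>) \<and> f 1 = 0 \<and>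
     (\<forall>s\<ge>0. \<forall>t\<ge>0. \<forall>u\<in>{0..1}.
        f ((1 - u) * s + u * t) \<le> ereal (1 - u) * f s + ereal u * f t) \<and>
     lsc_on {0..} f"

definition f_infinity :: "(real \<Rightarrow> ereal) \<Rightarrow> ereal" where
  "f_infinity f = Lim at_top (\<lambda>u. f u / ereal u)"

definition f_conj :: "(real \<Rightarrow> ereal) \<Rightarrow> real \<Rightarrow> ereal" where
  "f_conj f s = (SUP t\<in>{0..}. ereal (s * t) - f t)"

text \<open>\<open>scaled_conj f lam a\<close> stands for \<open>lam f*(a / lam)\<close>.  As \<open>0 * \<infinity> = 0\<close> in
  \<^typ>\<open>ereal\<close>, for \<open>lam = 0\<close> it is \<open>0\<close> if \<open>a \<le> 0\<close> and \<open>\<infinity>\<close> if \<open>a > 0\<close>.\<close>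

definition scaled_conj :: "(real \<Rightarrow> ereal) \<Rightarrow> real \<Rightarrow> real \<Rightarrow> ereal" where
  "scaled_conj f lam a = (SUP t\<in>{0..}. ereal (a * t) - ereal lam * f t)"

definition lebesgue_decomposition ::
    "'a measure \<Rightarrow> 'a measure \<Rightarrow> 'a measure \<Rightarrow> 'a measure \<Rightarrow> bool" where
  "lebesgue_decomposition P' P Pc Ps \<longleftrightarrow>
     sets Pc = sets P \<and> sets Ps = sets P \<and>
     (\<forall>A\<in>sets P. emeasure P A = emeasure Pc A + emeasure Ps A) \<and>
     absolutely_continuous P' Pc \<and>
     (\<exists>N\<in>sets P. emeasure P' N = 0 \<and> emeasure Ps (space P - N) = 0)"

text \<open>For finite measures on the same \<open>\<sigma>\<close>-algebra the decomposition exists and is unique up to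
  equality of measures, so the choice below is immaterial.\<close>

definition f_divergence :: "(real \<Rightarrow> ereal) \<Rightarrow> 'a measure \<Rightarrow> 'a measure \<Rightarrow> ereal" where
  "f_divergence f P' P =
     (let (Pc, Ps) = (SOME (Pc, Ps). lebesgue_decomposition P' P Pc Ps)
      in eintegral P' (\<lambda>\<xi>. f (enn2real (RN_deriv P' Pc \<xi>)))
         + f_infinity f * ereal (measure Ps (space Ps)))"

definition couplings :: "'a measure \<Rightarrow> 'a measure \<Rightarrow> ('a \<times> 'a) measure set" where
  "couplings P' P =
     {\<pi>. sets \<pi> = sets (P' \<Otimes>\<^sub>M P) \<and> prob_space \<pi> \<and> distr \<pi> P' fst = P' \<and> distr \<pi> P snd = P}"

definition transport_dist ::
    "('a \<Rightarrow> 'a \<Rightarrow> real) \<Rightarrow> 'a measure \<Rightarrow> 'a measure \<Rightarrow> ennreal" where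
  "transport_dist d P' P =
     (INF \<pi>\<in>couplings P' P. \<integral>\<^sup>+z. ennreal (d (fst z) (snd z)) \<partial>\<pi>)"

definition smoothed_divergence ::
    "'a::topological_space set \<Rightarrow> (real \<Rightarrow> ereal) \<Rightarrow> ('a \<Rightarrow> 'a \<Rightarrow> real) \<Rightarrow> real
      \<Rightarrow> 'a measure \<Rightarrow> 'a measure \<Rightarrow> ereal" where
  "smoothed_divergence S f d \<epsilon> P' P =
     (INF Q\<in>{Q\<in>borel_probs S. transport_dist d P' Q \<le> ennreal \<epsilon>}. f_divergence f Q P)"

definition predictor ::
    "'a::topological_space set \<Rightarrow> (real \<Rightarrow> ereal) \<Rightarrow> ('a \<Rightarrow> 'a \<Rightarrow> real) \<Rightarrow> ('x \<Rightarrow> 'a \<Rightarrow> real)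
      \<Rightarrow> real \<Rightarrow> real \<Rightarrow> 'x \<Rightarrow> 'a measure \<Rightarrow> ereal" where
  "predictor S f d l r \<epsilon> x Phat =
     (SUP P\<in>{P\<in>borel_probs S. smoothed_divergence S f d \<epsilon> Phat P \<le> ereal r}.
        ereal (\<integral>\<xi>. l x \<xi> \<partial>P))"

text \<open>The two real suprema below are taken over sets that are nonempty and bounded above
  whenever \<open>l x\<close> is upper semicontinuous on the nonempty compact set \<open>S\<close>, \<open>d \<xi> \<xi> = 0\<close> and
  \<open>\<delta> \<ge> 0\<close>.\<close>

definition loss_sup :: "'a set \<Rightarrow> ('x \<Rightarrow> 'a \<Rightarrow> real) \<Rightarrow> 'x \<Rightarrow> real" where
  "loss_sup S l x = (SUP \<xi>\<in>S. l x \<xi>)"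

definition loss_inflated ::
    "'a set \<Rightarrow> ('a \<Rightarrow> 'a \<Rightarrow> real) \<Rightarrow> ('x \<Rightarrow> 'a \<Rightarrow> real) \<Rightarrow> real \<Rightarrow> 'x \<Rightarrow> 'a \<Rightarrow> real" where
  "loss_inflated S d l \<delta> x \<xi> = (SUP \<xi>'\<in>{\<xi>'\<in>S. d \<xi> \<xi>' \<le> \<delta>}. l x \<xi>')"

definition delta_grid :: "'a::metric_space set \<Rightarrow> real \<Rightarrow> nat \<Rightarrow> real set" where
  "delta_grid S \<epsilon> K =
     {\<epsilon> * real k / real K | k. k \<le> K} \<union>
     {\<epsilon> * (diameter S / \<epsilon>) powr (real k / real K) | k. k \<le> K}"

definition discretized_objective ::
    "'a::metric_space set \<Rightarrow> (real \<Rightarrow> ereal) \<Rightarrow> ('a \<Rightarrow> 'a \<Rightarrow> real) \<Rightarrow> ('x \<Rightarrow> 'a \<Rightarrow> real)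
      \<Rightarrow> real \<Rightarrow> real \<Rightarrow> nat \<Rightarrow> 'x \<Rightarrow> 'a measure \<Rightarrow> real \<Rightarrow> real \<Rightarrow> real \<Rightarrow> ereal" where
  "discretized_objective S f d l r \<epsilon> K x Phat \<eta> lam \<gamma> =
     eintegral Phat (\<lambda>\<xi>. SUP \<delta>\<in>delta_grid S \<epsilon> K.
        scaled_conj f lam (loss_inflated S d l \<delta> x \<xi> - \<eta>) - ereal (\<delta> * \<gamma>))
     + ereal (r * lam + \<eta> + \<epsilon> * \<gamma>)"

text \<open>The disjunct \<open>f_infinity f = \<infinity>\<close> makes the constraint void in that case, including at
  \<open>lam = 0\<close>, where \<open>\<infinity> * 0 = 0\<close> would otherwise leave a genuine constraint.\<close>

definition discretized_predictor ::
    "'a::metric_space set \<Rightarrow> (real \<Rightarrow> ereal) \<Rightarrow> ('a \<Rightarrow> 'a \<Rightarrow> real) \<Rightarrow> ('x \<Rightarrow> 'a \<Rightarrow> real)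
      \<Rightarrow> real \<Rightarrow> real \<Rightarrow> nat \<Rightarrow> 'x \<Rightarrow> 'a measure \<Rightarrow> ereal" where
  "discretized_predictor S f d l r \<epsilon> K x Phat =
     (INF (\<eta>, lam, \<gamma>)\<in>{(\<eta>, lam, \<gamma>). 0 \<le> lam \<and> 0 \<le> \<gamma> \<and>
          (f_infinity f = \<infinity> \<or> ereal (loss_sup S l x - \<eta>) \<le> f_infinity f * ereal lam)}.
        discretized_objective S f d l r \<epsilon> K x Phat \<eta> lam \<gamma>)"

end

theory Submission
  imports Defs
begin

text \<open>
  The discretized predictor is the Lagrangian dual of a problem in which every point \<open>y\<close> is moved to
  a best point within a grid radius \<open>\<delta>\<close> and its mass is then multiplied by a likelihood ratio \<open>t\<close>.

  Lower bound: only three constraints (mass, divergence, transport budget) are dualised, so strong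
  duality follows from separating convex sets in \<open>\<real>\<^sup>4\<close>.  Convexity comes for free by mixing finitely
  many pure strategies, and a mixture is turned into a feasible distribution by a data-processing
  inequality.  The supremum is moved under the integral by measurable selection.

  Upper bound: weak duality is integrated along a coupling.  Rounding a transport distance up to the
  grid multiplies the transport price by \<open>(diam/\<epsilon>)\<^bsup>1/K\<^esup>\<close> beyond \<open>\<epsilon>\<close> and adds \<open>\<epsilon>/K\<close> below \<open>\<epsilon>\<close>.
\<close>

section \<open>Measurable selection of minimisers\<close>

text \<open>The obstacle is that the dual integrand is a supremum over radii and likelihood ratios
  at each point, while a primal strategy has to be one measurable choice. The grid is finite and
  positive rational ratios suffice, so the supremum is countable, hence an increasing limit of
  finite maxima, each attained by a measurable index. Positive ratios also keep every divergence
  cost finite, even if \<open>f 0\<close> is infinite. Singular mass, which no ratio describes,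
  enters as a separate amount \<open>s\<close>; since \<open>s\<close> may be arbitrarily large when
  \<open>f_infinity f\<close> is finite, boundedness of the Lagrangian in \<open>s\<close> is
  exactly the constraint linking \<open>\<eta>\<close>, \<open>lam\<close> and the recession slope.
  In the upper bound only the price \<open>\<epsilon> * \<gamma>\<close> has to be inflated, to
  \<open>\<gamma> * (\<rho> * \<epsilon> + \<epsilon> / K)\<close>, which is
  \<open>\<rho> + 1 / K\<close> times as much. The rest of the dual objective is nonnegative,
  because losses are, so it may be scaled by the same factor.\<close>

lemma closedin_superlevel:
  assumes "usc_on A g"
  shows "closedin (top_of_set A) {y \<in> A. c \<le> g y}"
proof -
  have "openin (top_of_set A) {y \<in> A. g y < c}"
  proof (subst openin_subopen, safe)
    fix y assume y: "y \<in> A" "g y < c"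
    then have "\<forall>\<^sub>F z in at y within A. g z < c"
      using assms by (auto simp: usc_on_def)
    then obtain U where "open U" "y \<in> U" "\<forall>z\<in>U. z \<noteq> y \<longrightarrow> z \<in> A \<longrightarrow> g z < c"
      by (auto simp: eventually_at_topological)
    with y show "\<exists>T. openin (top_of_set A) T \<and> y \<in> T \<and> T \<subseteq> {y \<in> A. g y < c}"
      by (intro exI[of _ "A \<inter> U"]) (auto simp: openin_open)
  qed
  moreover have "A - {y \<in> A. g y < c} = {y \<in> A. c \<le> g y}"
    by auto
  ultimately show ?thesis
    by (metis closedin_diff closedin_topspace topspace_euclidean_subtopology)
qed

lemma closedin_sublevel:
  assumes "lsc_on A g"
  shows "closedin (top_of_set A) {y \<in> A. g y \<le> c}"
proof -
  have "openin (top_of_set A) {y \<in> A. c < g y}"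
  proof (subst openin_subopen, safe)
    fix y assume y: "y \<in> A" "c < g y"
    then have "\<forall>\<^sub>F z in at y within A. c < g z"
      using assms by (auto simp: lsc_on_def)
    then obtain U where "open U" "y \<in> U" "\<forall>z\<in>U. z \<noteq> y \<longrightarrow> z \<in> A \<longrightarrow> c < g z"
      by (auto simp: eventually_at_topological)
    with y show "\<exists>T. openin (top_of_set A) T \<and> y \<in> T \<and> T \<subseteq> {y \<in> A. c < g y}"
      by (intro exI[of _ "A \<inter> U"]) (auto simp: openin_open)
  qed
  moreover have "A - {y \<in> A. c < g y} = {y \<in> A. g y \<le> c}"
    by auto
  ultimately show ?thesis
    by (metis closedin_diff closedin_topspace topspace_euclidean_subtopology)
qed

text \<open>The minimisers are the intersection of the closed sublevel sets at the levels
  \<open>h z\<close>. Finitely many of these share a point, namely the best of the finitely many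
  \<open>z\<close>, and compactness does the rest without an infimum of \<open>h\<close>.\<close>

lemma argmin_nonempty:
  fixes h :: "'a::t2_space \<Rightarrow> 'b::linorder"
  assumes "compact A" "A \<noteq> {}" "\<And>c. closed {y \<in> A. h y \<le> c}"
  shows "{y \<in> A. \<forall>z\<in>A. h y \<le> h z} \<noteq> {}"
proof -
  have "A \<inter> (\<Inter>z\<in>A. {y \<in> A. h y \<le> h z}) \<noteq> {}"
  proof (rule compact_imp_fip_image[OF assms(1)])
    fix I assume I: "finite I" "I \<subseteq> A"
    show "A \<inter> (\<Inter>z\<in>I. {y \<in> A. h y \<le> h z}) \<noteq> {}"
    proof (cases "I = {}")
      case False
      then obtain z where "z \<in> I" "\<forall>w\<in>I. h z \<le> h w"
        using I by (metis arg_min_least finite_has_minimal arg_min_if_finite(1))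
      then show ?thesis using I by blast
    qed (use assms in simp)
  qed (use assms in auto)
  then show ?thesis by blast
qed

text \<open>Measurability is tested by hitting closed sets: for a compact graph the hit sets are
  projections of compact sets, and for singleton values the test says that preimages of closed sets
  are measurable. Compact nonempty values make minima exist.\<close>

definition measurable_correspondence ::
    "'a measure \<Rightarrow> ('a \<Rightarrow> 'b::topological_space set) \<Rightarrow> bool" where
  "measurable_correspondence M \<Phi> \<longleftrightarrow>
     (\<forall>x\<in>space M. compact (\<Phi> x) \<and> \<Phi> x \<noteq> {}) \<and>
     (\<forall>F. closed F \<longrightarrow> {x \<in> space M. \<Phi> x \<inter> F \<noteq> {}} \<in> sets M)"

lemma measurable_correspondence_argmin:
  fixes h :: "'b::t2_space \<Rightarrow> real"
  assumes \<Phi>: "measurable_correspondence M \<Phi>"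
    and sub: "\<And>x. x \<in> space M \<Longrightarrow> \<Phi> x \<subseteq> S"
    and h: "\<And>c. closed {y \<in> S. h y \<le> c}"
  shows "measurable_correspondence M (\<lambda>x. {y \<in> \<Phi> x. \<forall>z\<in>\<Phi> x. h y \<le> h z})"
proof -
  have comp: "compact (\<Phi> x)" "\<Phi> x \<noteq> {}" if "x \<in> space M" for x
    using \<Phi> that by (auto simp: measurable_correspondence_def)
  have meas: "{x \<in> space M. \<Phi> x \<inter> F \<noteq> {}} \<in> sets M" if "closed F" for F
    using \<Phi> that by (auto simp: measurable_correspondence_def)
  have levels: "closed {y \<in> \<Phi> x \<inter> F. h y \<le> c}" if "x \<in> space M" "closed F" for x F c
  proof -
    have "{y \<in> \<Phi> x \<inter> F. h y \<le> c} = \<Phi> x \<inter> F \<inter> {y \<in> S. h y \<le> c}"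
      using sub[OF that(1)] by auto
    then show ?thesis
      using comp[OF that(1)] that h by (metis closed_Int compact_imp_closed)
  qed
  show ?thesis
    unfolding measurable_correspondence_def
  proof (intro conjI ballI allI impI)
    fix x assume x: "x \<in> space M"
    show "{y \<in> \<Phi> x. \<forall>z\<in>\<Phi> x. h y \<le> h z} \<noteq> {}"
      using argmin_nonempty[of "\<Phi> x" h] comp[OF x] levels[OF x, of UNIV] by simp
    have "{y \<in> \<Phi> x. \<forall>z\<in>\<Phi> x. h y \<le> h z} = \<Phi> x \<inter> (\<Inter>z\<in>\<Phi> x. {y \<in> \<Phi> x. h y \<le> h z})"
      by auto
    also have "compact \<dots>"
      using comp[OF x] levels[OF x, of UNIV] by (intro compact_Int_closed closed_INT) auto
    finally show "compact {y \<in> \<Phi> x. \<forall>z\<in>\<Phi> x. h y \<le> h z}" .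
  next
    fix F :: "'b set" assume F: "closed F"
    let ?L = "\<lambda>q::rat. {y \<in> S. h y \<le> of_rat q}"
    \<comment> \<open>A minimiser lies in \<open>F\<close> iff the minimum over the part in \<open>F\<close> is no larger, and this
      comparison only needs rational levels.\<close>
    have "{x \<in> space M. {y \<in> \<Phi> x. \<forall>z\<in>\<Phi> x. h y \<le> h z} \<inter> F \<noteq> {}} =
        {x \<in> space M. \<Phi> x \<inter> F \<noteq> {}} \<inter>
        (\<Inter>q. (space M - {x \<in> space M. \<Phi> x \<inter> ?L q \<noteq> {}}) \<union> {x \<in> space M. \<Phi> x \<inter> (F \<inter> ?L q) \<noteq> {}})"
      (is "?A = ?B")
    proof (intro set_eqI iffI)
      fix x assume "x \<in> ?A"
      then obtain y where x: "x \<in> space M" and y: "y \<in> \<Phi> x" "y \<in> F" "\<forall>z\<in>\<Phi> x. h y \<le> h z"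
        by auto
      then have "\<Phi> x \<inter> (F \<inter> ?L q) \<noteq> {}" if "\<Phi> x \<inter> ?L q \<noteq> {}" for q
      proof -
        from that obtain z where "z \<in> \<Phi> x" "z \<in> ?L q" by blast
        then have "y \<in> \<Phi> x \<inter> (F \<inter> ?L q)" using y sub[OF x] by force
        then show ?thesis by blast
      qed
      then show "x \<in> ?B" using x y by blast
    next
      fix x assume x: "x \<in> ?B"
      then have xM: "x \<in> space M" and ne: "\<Phi> x \<inter> F \<noteq> {}" by auto
      have "compact (\<Phi> x \<inter> F)" using comp[OF xM] F by (intro compact_Int_closed)
      from argmin_nonempty[OF this ne, of h] levels[OF xM F]
      obtain y where y: "y \<in> \<Phi> x" "y \<in> F" "\<forall>z\<in>\<Phi> x \<inter> F. h y \<le> h z" by auto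
      have "h y \<le> h z" if z: "z \<in> \<Phi> x" for z
      proof (rule ccontr)
        assume "\<not> h y \<le> h z"
        then obtain q where q: "h z < of_rat q" "of_rat q < h y"
          using of_rat_dense[of "h z" "h y"] by auto
        then have "\<Phi> x \<inter> ?L q \<noteq> {}" using z sub[OF xM] by force
        then have "\<Phi> x \<inter> (F \<inter> ?L q) \<noteq> {}" using x by blast
        then show False using y q by force
      qed
      then show "x \<in> ?A" using xM y by auto
    qed
    also have "?B \<in> sets M"
    proof (intro sets.Int[OF meas[OF F]] sets.countable_INT' image_subsetI)
      fix q
      have "closed (?L q)" "closed (F \<inter> ?L q)"
        using F h by auto
      then show "(space M - {x \<in> space M. \<Phi> x \<inter> ?L q \<noteq> {}}) \<union>
          {x \<in> space M. \<Phi> x \<inter> (F \<inter> ?L q) \<noteq> {}} \<in> sets M"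
        by (intro sets.Un sets.compl_sets meas)
    qed simp_all
    finally show "?A \<in> sets M" .
  qed
qed

text \<open>Passing to the minimisers of \<open>h\<close> makes \<open>h\<close> constant on each
  value, and shrinking a value preserves constancy already obtained. Hence a finite list can be
  treated one function at a time.\<close>

lemma measurable_correspondence_unique:
  fixes hs :: "('b::t2_space \<Rightarrow> real) list"
  assumes "measurable_correspondence M \<Phi>"
    and "\<And>x. x \<in> space M \<Longrightarrow> \<Phi> x \<subseteq> S"
    and "\<And>h c. h \<in> set hs \<Longrightarrow> closed {y \<in> S. h y \<le> c}"
  shows "\<exists>\<Psi>. measurable_correspondence M \<Psi> \<and>
    (\<forall>x\<in>space M. \<Psi> x \<subseteq> \<Phi> x \<and> (\<forall>h\<in>set hs. \<forall>y\<in>\<Psi> x. \<forall>z\<in>\<Psi> x. h y = h z))"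
  using assms(3)
proof (induction hs)
  case Nil
  then show ?case using assms by auto
next
  case (Cons h hs)
  then obtain \<Psi> where \<Psi>: "measurable_correspondence M \<Psi>"
    "\<And>x. x \<in> space M \<Longrightarrow> \<Psi> x \<subseteq> \<Phi> x"
    "\<And>x. x \<in> space M \<Longrightarrow> \<forall>h\<in>set hs. \<forall>y\<in>\<Psi> x. \<forall>z\<in>\<Psi> x. h y = h z"
    by auto
  have "measurable_correspondence M (\<lambda>x. {y \<in> \<Psi> x. \<forall>z\<in>\<Psi> x. h y \<le> h z})"
    using \<Psi>(1)
  proof (rule measurable_correspondence_argmin)
    show "\<Psi> x \<subseteq> S" if "x \<in> space M" for x
      using \<Psi>(2) assms(2) that by blast
  qed (use Cons.prems in auto)
  then show ?case
  proof (intro exI conjI ballI)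
    fix x assume x: "x \<in> space M"
    show "{y \<in> \<Psi> x. \<forall>z\<in>\<Psi> x. h y \<le> h z} \<subseteq> \<Phi> x"
      using \<Psi>(2)[OF x] by blast
    fix g y z
    assume "g \<in> set (h # hs)" and yz: "y \<in> {y \<in> \<Psi> x. \<forall>z\<in>\<Psi> x. h y \<le> h z}"
      "z \<in> {y \<in> \<Psi> x. \<forall>z\<in>\<Psi> x. h y \<le> h z}"
    then consider "g = h" | "g \<in> set hs" by auto
    then show "g y = g z"
      using yz \<Psi>(3)[OF x] by cases (auto intro: antisym)
  qed
qed

text \<open>Minimising all coordinates one after the other makes the correspondence single-valued.\<close>

theorem measurable_argmin_selection:
  fixes h :: "'b::euclidean_space \<Rightarrow> real"
  assumes \<Phi>: "measurable_correspondence M \<Phi>"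
    and sub: "\<And>x. x \<in> space M \<Longrightarrow> \<Phi> x \<subseteq> S" and "closed S"
    and h: "\<And>c. closed {y \<in> S. h y \<le> c}"
  obtains T where "T \<in> borel_measurable M"
    "\<And>x. x \<in> space M \<Longrightarrow> T x \<in> \<Phi> x"
    "\<And>x z. x \<in> space M \<Longrightarrow> z \<in> \<Phi> x \<Longrightarrow> h (T x) \<le> h z"
proof -
  let ?A = "\<lambda>x. {y \<in> \<Phi> x. \<forall>z\<in>\<Phi> x. h y \<le> h z}"
  obtain bs :: "'b list" where bs: "set bs = Basis"
    using finite_list[OF finite_Basis] by blast
  have cl: "closed {y \<in> S. y \<bullet> b \<le> c}" for b c
    using \<open>closed S\<close> closed_halfspace_component_le[of b c]
    by (simp add: Collect_conj_eq closed_Int inner_commute closed_halfspace_le)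
  have "\<exists>\<Psi>. measurable_correspondence M \<Psi> \<and> (\<forall>x\<in>space M. \<Psi> x \<subseteq> ?A x \<and>
      (\<forall>h\<in>set (map (\<lambda>b y. y \<bullet> b) bs). \<forall>y\<in>\<Psi> x. \<forall>z\<in>\<Psi> x. h y = h z))"
  proof (rule measurable_correspondence_unique)
    show "measurable_correspondence M ?A"
      by (rule measurable_correspondence_argmin[OF \<Phi> sub h])
    show "?A x \<subseteq> S" if "x \<in> space M" for x
      using sub[OF that] by blast
  qed (use cl in auto)
  then obtain \<Psi> where \<Psi>: "measurable_correspondence M \<Psi>" and
    sel: "\<forall>x\<in>space M. \<Psi> x \<subseteq> ?A x \<and>
      (\<forall>h\<in>set (map (\<lambda>b y. y \<bullet> b) bs). \<forall>y\<in>\<Psi> x. \<forall>z\<in>\<Psi> x. h y = h z)"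
    by (elim exE conjE)
  have single: "y = z" if "x \<in> space M" "y \<in> \<Psi> x" "z \<in> \<Psi> x" for x y z
  proof (rule euclidean_eqI)
    fix b :: 'b assume "b \<in> Basis"
    then have "(\<lambda>y. y \<bullet> b) \<in> set (map (\<lambda>b y. y \<bullet> b) bs)" using bs by simp
    with bspec[OF sel that(1)] that(2,3) show "y \<bullet> b = z \<bullet> b" by meson
  qed
  define T where "T x = (SOME y. y \<in> \<Psi> x)" for x
  have T: "T x \<in> \<Psi> x" if "x \<in> space M" for x
    using \<Psi> that unfolding T_def measurable_correspondence_def by (metis ex_in_conv someI_ex)
  show thesis
  proof (rule that)
    show "T \<in> borel_measurable M"
    proof (rule borel_measurableI)
      fix U :: "'b set" assume "open U"
      \<comment> \<open>Each \<open>\<Psi> x\<close> is the singleton of \<open>T x\<close>, so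
        \<open>T x\<close> lies in \<open>U\<close> exactly when \<open>\<Psi> x\<close> misses the
        closed complement of \<open>U\<close>.\<close>
      then have "{x \<in> space M. \<Psi> x \<inter> - U \<noteq> {}} \<in> sets M"
        using \<Psi> by (simp add: measurable_correspondence_def closed_Compl)
      then have "space M - {x \<in> space M. \<Psi> x \<inter> - U \<noteq> {}} \<in> sets M"
        by (rule sets.Diff[OF sets.top])
      also have "space M - {x \<in> space M. \<Psi> x \<inter> - U \<noteq> {}} = T -` U \<inter> space M"
        using T single by blast
      finally show "T -` U \<inter> space M \<in> sets M" .
    qed
  next
    fix x assume x: "x \<in> space M"
    then have A: "T x \<in> ?A x" using sel T[OF x] by blast
    then show "T x \<in> \<Phi> x" by simp
    show "h (T x) \<le> h z" if "z \<in> \<Phi> x" for z using A that by simp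
  qed
qed

text \<open>This turns a finite pointwise maximum into the value of a single measurable strategy, so
  that bounds on strategies become bounds on integrals of maxima.\<close>

lemma measurable_argmax_index:
  fixes c :: "nat \<Rightarrow> 'a \<Rightarrow> real"
  assumes "\<And>i. c i \<in> borel_measurable M"
  obtains I where "I \<in> measurable M (count_space UNIV)"
    "\<And>x. I x \<le> n" "\<And>x i. i \<le> n \<Longrightarrow> c i x \<le> c (I x) x"
proof -
  have "\<exists>I\<in>measurable M (count_space UNIV). (\<forall>x. I x \<le> n) \<and> (\<forall>x. \<forall>i\<le>n. c i x \<le> c (I x) x)"
  proof (induction n)
    case 0
    show ?case by (intro bexI[of _ "\<lambda>_. 0"]) auto
  next
    case (Suc n)
    then obtain I where I: "I \<in> measurable M (count_space UNIV)"
      "\<forall>x. I x \<le> n" "\<forall>x. \<forall>i\<le>n. c i x \<le> c (I x) x" by blast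
    have [measurable]: "(\<lambda>x. c (I x) x) \<in> borel_measurable M"
      using measurable_compose_countable[OF assms I(1)] .
    note [measurable] = I(1) assms
    show ?case
    proof (intro bexI conjI allI impI)
      show "(\<lambda>x. if c (Suc n) x \<le> c (I x) x then I x else Suc n) \<in> measurable M (count_space UNIV)"
        by measurable
    next
      fix x show "(if c (Suc n) x \<le> c (I x) x then I x else Suc n) \<le> Suc n"
        using I(2) by (simp add: le_SucI)
    next
      fix x i assume "i \<le> Suc n"
      then show "c i x \<le> c (if c (Suc n) x \<le> c (I x) x then I x else Suc n) x"
        using I(3) by (cases "i = Suc n") (auto simp: le_Suc_eq not_le intro: order.trans[OF _ less_imp_le])
    qed
  qed
  then show thesis using that by blast
qed

section \<open>Extended-real integrals\<close>

lemma enn2ereal_eq_ereal_enn2real: "x < \<infinity> \<Longrightarrow> enn2ereal x = ereal (enn2real x)"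
  by (cases x) auto

lemma eintegral_real:
  assumes "integrable M g"
  shows "eintegral M (\<lambda>x. ereal (g x)) = ereal (\<integral>x. g x \<partial>M)"
proof -
  have p: "(\<integral>\<^sup>+x. ennreal (g x) \<partial>M) < \<infinity>" "(\<integral>\<^sup>+x. ennreal (- g x) \<partial>M) < \<infinity>"
    using assms by (auto simp: real_integrable_def top.not_eq_extremum)
  show ?thesis
    using p unfolding eintegral_def real_lebesgue_integral_def[OF assms]
    by (simp add: e2ennreal_ereal enn2ereal_eq_ereal_enn2real)
qed

lemma eintegral_cong_AE:
  assumes "AE x in M. g x = h x"
  shows "eintegral M g = eintegral M h"
  unfolding eintegral_def
  by (intro arg_cong2[where f = "(-)"] arg_cong[where f = enn2ereal] nn_integral_cong_AE)
    (use assms in auto)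

text \<open>The integrable minorant keeps the negative part finite, so a value other than infinity
  bounds the positive part too, and the Bochner integral can take over.\<close>

lemma eintegral_finite:
  assumes [measurable]: "G \<in> borel_measurable M" and g0: "integrable M g0"
    and le: "\<And>x. x \<in> space M \<Longrightarrow> ereal (g0 x) \<le> G x"
    and fin: "eintegral M G \<noteq> \<infinity>"
  shows "integrable M (\<lambda>x. real_of_ereal (G x))"
    and "AE x in M. ereal (real_of_ereal (G x)) = G x"
    and "eintegral M G = ereal (\<integral>x. real_of_ereal (G x) \<partial>M)"
proof -
  have [measurable]: "g0 \<in> borel_measurable M" using g0 by auto
  have "(\<integral>\<^sup>+x. e2ennreal (- G x) \<partial>M) \<le> (\<integral>\<^sup>+x. ennreal (- g0 x) \<partial>M)"
  proof (rule nn_integral_mono)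
    fix x assume "x \<in> space M"
    from le[OF this] have "- G x \<le> ereal (- g0 x)"
      by (metis ereal_minus_le_minus uminus_ereal.simps(1))
    from e2ennreal_mono[OF this] show "e2ennreal (- G x) \<le> ennreal (- g0 x)"
      by (simp add: e2ennreal_ereal)
  qed
  also have "\<dots> < \<infinity>"
    using g0 by (auto simp: real_integrable_def top.not_eq_extremum)
  finally have neg: "(\<integral>\<^sup>+x. e2ennreal (- G x) \<partial>M) < \<infinity>" .
  have pos: "(\<integral>\<^sup>+x. e2ennreal (G x) \<partial>M) < \<infinity>"
  proof (rule ccontr)
    assume "\<not> ?thesis"
    then have "(\<integral>\<^sup>+x. e2ennreal (G x) \<partial>M) = \<infinity>" by (metis infinity_ennreal_def top.not_eq_extremum)
    then show False using fin neg by (simp add: eintegral_def enn2ereal_eq_ereal_enn2real)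
  qed
  have "AE x in M. e2ennreal (G x) \<noteq> \<infinity>"
    using pos by (intro nn_integral_noteq_infinite) auto
  then show real: "AE x in M. ereal (real_of_ereal (G x)) = G x"
  proof (rule AE_mp[OF _ AE_I2[OF impI]])
    fix x assume x: "x \<in> space M" "e2ennreal (G x) \<noteq> \<infinity>"
    with le[OF x(1)] show "ereal (real_of_ereal (G x)) = G x"
      by (cases "G x") auto
  qed
  have 1: "(\<integral>\<^sup>+x. ennreal (real_of_ereal (G x)) \<partial>M) = (\<integral>\<^sup>+x. e2ennreal (G x) \<partial>M)"
    using real by (intro nn_integral_cong_AE) (auto elim!: eventually_mono simp flip: e2ennreal_ereal)
  have 2: "(\<integral>\<^sup>+x. ennreal (- real_of_ereal (G x)) \<partial>M) = (\<integral>\<^sup>+x. e2ennreal (- G x) \<partial>M)"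
    using real by (intro nn_integral_cong_AE)
      (auto elim!: eventually_mono simp flip: e2ennreal_ereal uminus_ereal.simps(1))
  show int: "integrable M (\<lambda>x. real_of_ereal (G x))"
    using 1 2 pos neg by (simp add: real_integrable_def top.not_eq_extremum)
  have "eintegral M G = eintegral M (\<lambda>x. ereal (real_of_ereal (G x)))"
    using real by (intro eintegral_cong_AE) (auto elim: eventually_mono)
  then show "eintegral M G = ereal (\<integral>x. real_of_ereal (G x) \<partial>M)"
    using eintegral_real[OF int] by simp
qed

lemma eintegral_ge:
  assumes G: "G \<in> borel_measurable M" and g0: "integrable M g0"
    and le: "\<And>x. x \<in> space M \<Longrightarrow> ereal (g0 x) \<le> G x"
  shows "ereal (\<integral>x. g0 x \<partial>M) \<le> eintegral M G"
proof (cases "eintegral M G = \<infinity>")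
  case False
  note fin = eintegral_finite[OF G g0 le False]
  have "(\<integral>x. g0 x \<partial>M) \<le> (\<integral>x. real_of_ereal (G x) \<partial>M)"
  proof (rule integral_mono_AE[OF g0 fin(1)])
    show "AE x in M. g0 x \<le> real_of_ereal (G x)"
    proof (rule AE_mp[OF fin(2) AE_I2[OF impI]])
      fix x assume "x \<in> space M" "ereal (real_of_ereal (G x)) = G x"
      then show "g0 x \<le> real_of_ereal (G x)" using le[of x] by (metis ereal_less_eq(3))
    qed
  qed
  then show ?thesis using fin(3) by simp
qed simp

text \<open>Monotone convergence without a sign condition: the increments over \<open>g 0\<close>
  are nonnegative, and the uniform bound \<open>c\<close> makes the supremum finite almost
  everywhere.\<close>

lemma eintegral_SUP_le:
  fixes g :: "nat \<Rightarrow> 'a \<Rightarrow> real"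
  assumes int: "\<And>n. integrable M (g n)"
    and inc: "\<And>m n x. m \<le> n \<Longrightarrow> x \<in> space M \<Longrightarrow> g m x \<le> g n x"
    and le: "\<And>n. (\<integral>x. g n x \<partial>M) \<le> c"
    and G: "\<And>x. x \<in> space M \<Longrightarrow> G x = (SUP n. ereal (g n x))"
  shows "eintegral M G \<le> ereal c"
proof -
  have [measurable]: "g n \<in> borel_measurable M" for n using int by auto
  have "(\<integral>\<^sup>+x. (SUP n. ennreal (g n x - g 0 x)) \<partial>M) = (SUP n. \<integral>\<^sup>+x. ennreal (g n x - g 0 x) \<partial>M)"
    by (intro nn_integral_monotone_convergence_SUP_AE AE_I2)
      (auto intro!: ennreal_leI inc)
  also have "\<dots> \<le> ennreal (c - (\<integral>x. g 0 x \<partial>M))"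
  proof (rule SUP_least)
    fix n
    have "(\<integral>\<^sup>+x. ennreal (g n x - g 0 x) \<partial>M) = ennreal (\<integral>x. g n x - g 0 x \<partial>M)"
      using int inc by (intro nn_integral_eq_integral) auto
    also have "\<dots> \<le> ennreal (c - (\<integral>x. g 0 x \<partial>M))"
      using int le[of n] by (intro ennreal_leI) simp
    finally show "(\<integral>\<^sup>+x. ennreal (g n x - g 0 x) \<partial>M) \<le> ennreal (c - (\<integral>x. g 0 x \<partial>M))" .
  qed
  finally have fin: "(\<integral>\<^sup>+x. (SUP n. ennreal (g n x - g 0 x)) \<partial>M) < \<infinity>"
    by (rule order.strict_trans1) simp
  have "AE x in M. (SUP n. ennreal (g n x - g 0 x)) \<noteq> \<infinity>"
    using fin by (intro nn_integral_noteq_infinite) auto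
  then have conv: "AE x in M. (\<lambda>n. g n x) \<longlonglongrightarrow> real_of_ereal (G x) \<and> G x = ereal (real_of_ereal (G x))"
  proof (rule AE_mp[OF _ AE_I2[OF impI]])
    fix x assume x: "x \<in> space M" "(SUP n. ennreal (g n x - g 0 x)) \<noteq> \<infinity>"
    then obtain C where C: "(SUP n. ennreal (g n x - g 0 x)) = ennreal C" "0 \<le> C"
      by (metis ennreal_cases infinity_ennreal_def)
    have bound: "g n x \<le> g 0 x + C" for n
    proof -
      have "ennreal (g n x - g 0 x) \<le> ennreal C"
        unfolding C(1)[symmetric] by (intro SUP_upper) auto
      then show ?thesis using C(2) by (simp add: ennreal_le_iff)
    qed
    have "incseq (\<lambda>n. ereal (g n x))" using inc x(1) by (auto simp: incseq_def)
    then have lim: "(\<lambda>n. ereal (g n x)) \<longlonglongrightarrow> G x"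
      using G[OF x(1)] LIMSEQ_SUP by metis
    have "G x \<le> ereal (g 0 x + C)" using bound by (auto simp: G[OF x(1)] intro!: SUP_least)
    moreover have "ereal (g 0 x) \<le> G x" by (auto simp: G[OF x(1)] intro!: SUP_upper)
    ultimately have "G x = ereal (real_of_ereal (G x))" by (cases "G x") auto
    then show "(\<lambda>n. g n x) \<longlonglongrightarrow> real_of_ereal (G x) \<and> G x = ereal (real_of_ereal (G x))"
      using lim by (metis lim_ereal)
  qed
  have inte: "integrable M (\<lambda>x. real_of_ereal (G x))" and
    lim: "(\<lambda>n. \<integral>x. g n x \<partial>M) \<longlonglongrightarrow> (\<integral>x. real_of_ereal (G x) \<partial>M)"
  proof -
    have mono: "incseq (\<lambda>n. \<integral>x. g n x \<partial>M)"
      using int inc by (auto simp: incseq_def intro!: integral_mono)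
    then obtain L where L: "(\<lambda>n. \<integral>x. g n x \<partial>M) \<longlonglongrightarrow> L"
      using le incseq_convergent[OF mono, of c] by blast
    have Gm: "(\<lambda>x. real_of_ereal (G x)) \<in> borel_measurable M"
    proof -
      have "(\<lambda>x. SUP n. ereal (g n x)) \<in> borel_measurable M" by measurable
      then have "G \<in> borel_measurable M" using G by (simp cong: measurable_cong)
      then show ?thesis by measurable
    qed
    have AEinc: "AE x in M. incseq (\<lambda>n. g n x)" using inc by (auto simp: incseq_def)
    have AElim: "AE x in M. (\<lambda>n. g n x) \<longlonglongrightarrow> real_of_ereal (G x)"
      using conv by (auto elim: eventually_mono)
    show "integrable M (\<lambda>x. real_of_ereal (G x))"
      by (rule integrable_monotone_convergence[OF int AEinc AElim L Gm])
    show "(\<lambda>n. \<integral>x. g n x \<partial>M) \<longlonglongrightarrow> (\<integral>x. real_of_ereal (G x) \<partial>M)"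
      using integral_monotone_convergence[OF int AEinc AElim L Gm] L by simp
  qed
  have "eintegral M G = eintegral M (\<lambda>x. ereal (real_of_ereal (G x)))"
    using conv by (intro eintegral_cong_AE) (auto elim: eventually_mono)
  also have "\<dots> = ereal (\<integral>x. real_of_ereal (G x) \<partial>M)" by (rule eintegral_real[OF inte])
  also have "\<dots> \<le> ereal c" using LIMSEQ_le_const2[OF lim] le by auto
  finally show ?thesis .
qed

section \<open>Divergence generators as suprema of affine functions\<close>

lemma generator_finite:
  assumes "divergence_generator f" "t > 0"
  shows "f t = ereal (real_of_ereal (f t))"
  using assms by (auto simp: divergence_generator_def ereal_real)

text \<open>A point \<open>q > 0\<close> is interior to the effective domain \<open>I\<close>, so
  the infimum of the difference quotients to its right is a subgradient there. Outside
  \<open>I\<close> the inequality is trivial.\<close>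

lemma generator_subgradient:
  assumes f: "divergence_generator f" and q: "q > 0"
  obtains a b where "\<And>u. u \<ge> 0 \<Longrightarrow> ereal (a * u + b) \<le> f u" "f q = ereal (a * q + b)"
proof -
  define I where "I = {u. u \<ge> 0 \<and> f u \<noteq> \<infinity>}"
  let ?F = "\<lambda>u. real_of_ereal (f u)"
  have real: "f u = ereal (?F u)" if "u \<in> I" for u
    using that f by (auto simp: I_def divergence_generator_def ereal_real)
  have conv: "f ((1 - w) * s + w * t) \<le> ereal ((1 - w) * ?F s + w * ?F t)"
    if "s \<in> I" "t \<in> I" "0 \<le> w" "w \<le> 1" for s t w
  proof -
    have "f ((1 - w) * s + w * t) \<le> ereal (1 - w) * f s + ereal w * f t"
      using f that by (auto simp: divergence_generator_def I_def)
    then show ?thesis using real[OF that(1)] real[OF that(2)] by (metis plus_ereal.simps(1) times_ereal.simps(1))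
  qed
  have in_I: "(1 - w) * s + w * t \<in> I" if "s \<in> I" "t \<in> I" "0 \<le> w" "w \<le> 1" for s t w
    using conv[OF that] that by (auto simp: I_def)
  have "convex_on I ?F"
  proof (rule convex_onI)
    show "convex I"
      unfolding convex_alt using in_I by simp
    fix w s t :: real assume w: "0 < w" "w < 1" and st: "s \<in> I" "t \<in> I"
    have "ereal (?F ((1 - w) * s + w * t)) \<le> ereal ((1 - w) * ?F s + w * ?F t)"
      using conv[OF st, of w] real[OF in_I[OF st, of w]] w by simp
    then show "?F ((1 - w) *\<^sub>R s + w *\<^sub>R t) \<le> (1 - w) * ?F s + w * ?F t" by simp
  qed
  moreover have "q \<in> interior I"
    using q f
    by (intro interiorI[of "{0<..}"]) (auto simp: I_def divergence_generator_def)
  ultimately have "\<And>u. u \<in> I \<Longrightarrow>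
      ?F q + Inf ((\<lambda>t. (?F q - ?F t) / (q - t)) ` ({q<..} \<inter> I)) * (u - q) \<le> ?F u"
    by (intro convex_le_Inf_differential)
  then obtain a where a: "\<And>u. u \<in> I \<Longrightarrow> ?F q + a * (u - q) \<le> ?F u" by blast
  show thesis
  proof (rule that)
    fix u :: real assume "u \<ge> 0"
    show "ereal (a * u + (?F q - a * q)) \<le> f u"
    proof (cases "f u = \<infinity>")
      case False
      then have "u \<in> I" using \<open>u \<ge> 0\<close> by (auto simp: I_def)
      from a[OF this] real[OF this] show ?thesis
        by (metis add_diff_eq add.commute ereal_less_eq(3) right_diff_distrib)
    qed simp
  qed (use generator_finite[OF f q] in simp)
qed

text \<open>At 0 there may be no supporting line, as the slope can be minus infinity. Tangents at
  small \<open>q > 0\<close> replace it: since \<open>f 1 = 0\<close>, a tangent satisfies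
  \<open>a + b \<le> 0\<close>, so \<open>c' < a * q + b \<le> b * (1 - q)\<close> and
  \<open>b\<close> exceeds \<open>c' / (1 - q)\<close>, which tends to \<open>c'\<close>. Lower
  semicontinuity supplies \<open>c' < f q\<close>.\<close>

lemma generator_minorant_at_zero:
  assumes f: "divergence_generator f" and c: "ereal c < f 0"
  obtains a b where "\<And>u. u \<ge> 0 \<Longrightarrow> ereal (a * u + b) \<le> f u" "c < b"
proof -
  let ?F = "\<lambda>u. real_of_ereal (f u)"
  obtain c' where c': "ereal c < ereal c'" "ereal c' < f 0"
    using ereal_dense2[OF c] by blast
  have "\<forall>\<^sub>F q in at 0 within {0..}. ereal c' < f q"
    using f c'(2) by (auto simp: divergence_generator_def lsc_on_def)
  then have 1: "\<forall>\<^sub>F q in at_right 0. ereal c' < f q"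
    by (rule filter_leD[OF at_le, rotated]) auto
  have "((\<lambda>q. c' / (1 - q)) \<longlongrightarrow> c' / (1 - 0)) (at_right 0)"
    by (intro tendsto_intros) auto
  then have 2: "\<forall>\<^sub>F q in at_right 0. c < c' / (1 - q)"
    using c' by (intro order_tendstoD) auto
  have 3: "\<forall>\<^sub>F q in at_right (0::real). q < 1 \<and> 0 < q"
    by (auto simp: eventually_at_right_field intro!: exI[of _ 1])
  from eventually_conj[OF 1 eventually_conj[OF 2 3]]
  obtain q where q: "ereal c' < f q" "c < c' / (1 - q)" "q < 1" "0 < q"
    using eventually_happens'[OF trivial_limit_at_right_real] by (smt (verit))
  obtain a b where ab: "\<And>u. u \<ge> 0 \<Longrightarrow> ereal (a * u + b) \<le> f u" "f q = ereal (a * q + b)"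
    using generator_subgradient[OF f q(4)] by blast
  have "a + b \<le> 0" using ab(1)[of 1] f by (simp add: divergence_generator_def)
  have "c' < a * q + b" using q(1) ab(2) by simp
  also have "a * q + b \<le> (- b) * q + b"
    using \<open>a + b \<le> 0\<close> q by (intro add_right_mono mult_right_mono) auto
  finally have "c' / (1 - q) < b" using q by (simp add: field_simps)
  then show thesis using that[OF ab(1)] q(2) by simp
qed

text \<open>One countable family describes both \<open>f\<close> and its recession slope, which
  makes selection among minorants measurable. Rational coefficients suffice because lowering slope
  and intercept preserves a minorant on the half line.\<close>

lemma generator_minorants:
  assumes f: "divergence_generator f"
  obtains a b :: "nat \<Rightarrow> real" where
    "\<forall>u\<ge>0. f u = (SUP n. ereal (a n * u + b n))"
    "f_infinity f = (SUP n. ereal (a n))"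
proof -
  define R where "R = {(a, b) \<in> \<rat> \<times> \<rat>. \<forall>u\<ge>0. ereal (a * u + b) \<le> f u}"
  have "countable R"
    by (rule countable_subset[of _ "\<rat> \<times> \<rat>"]) (auto simp: R_def countable_rat)
  have approx: "\<exists>(a', b')\<in>R. a - e < a' \<and> b - e < b'"
    if m: "\<And>u. u \<ge> 0 \<Longrightarrow> ereal (a * u + b) \<le> f u" and "e > 0" for a b e
  proof -
    obtain a' b' where ab: "a' \<in> \<rat>" "a - e < a'" "a' < a" "b' \<in> \<rat>" "b - e < b'" "b' < b"
      using Rats_dense_in_real[of "a - e" a] Rats_dense_in_real[of "b - e" b] \<open>e > 0\<close> by auto
    have "ereal (a' * u + b') \<le> f u" if "u \<ge> 0" for u
    proof -
      have "a' * u + b' \<le> a * u + b" using ab that by (intro add_mono mult_right_mono) auto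
      then show ?thesis using m[OF that] by (metis ereal_less_eq(3) order_trans)
    qed
    then show ?thesis using ab by (intro bexI[of _ "(a', b')"]) (auto simp: R_def)
  qed
  have "R \<noteq> {}"
    using generator_subgradient[OF f, of 1] approx[of _ _ 1] by (metis empty_iff zero_less_one)
  define a where "a n = fst (from_nat_into R n)" for n
  define b where "b n = snd (from_nat_into R n)" for n
  have le: "ereal (a n * u + b n) \<le> f u" if "u \<ge> 0" for u n
    using from_nat_into[OF \<open>R \<noteq> {}\<close>, of n] that unfolding a_def b_def R_def by auto
  have hit: "\<exists>n. a' = a n \<and> b' = b n" if "(a', b') \<in> R" for a' b'
    using from_nat_into_surj[OF \<open>countable R\<close> that] by (metis a_def b_def fst_conv snd_conv)
  have approx_n: "\<exists>n. a' - e < a n \<and> b' - e < b n"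
    if m: "\<And>u. u \<ge> 0 \<Longrightarrow> ereal (a' * u + b') \<le> f u" and "e > 0" for a' b' e
    using approx[OF that] hit by blast
  have ge: "ereal (a' * u + b') \<le> (SUP n. ereal (a n * u + b n))"
    if m: "\<And>u. u \<ge> 0 \<Longrightarrow> ereal (a' * u + b') \<le> f u" and "u \<ge> 0" for a' b' u
  proof (rule ereal_le_epsilon2)
    fix e :: real assume "0 < e"
    \<comment> \<open>The slope error is multiplied by \<open>u\<close> and the intercept error
      counts once, so the total is \<open>e' * (u + 1) = e\<close>.\<close>
    define e' where "e' = e / (u + 1)"
    have "e' > 0" using \<open>0 < e\<close> that(2) by (simp add: e'_def)
    have "e' * (u + 1) = e" using that(2) by (simp add: e'_def)
    then have "e' * u + e' = e" by (simp add: algebra_simps)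
    obtain n where n: "a' - e' < a n" "b' - e' < b n" using approx_n[OF m \<open>e' > 0\<close>] by blast
    have "(a' - e') * u + (b' - e') \<le> a n * u + b n"
      using n that(2) by (intro add_mono mult_right_mono) auto
    then have "a' * u + b' \<le> a n * u + b n + e"
      using \<open>e' * u + e' = e\<close> by (simp add: algebra_simps)
    then have "ereal (a' * u + b') \<le> ereal (a n * u + b n) + ereal e" by simp
    also have "\<dots> \<le> (SUP n. ereal (a n * u + b n)) + ereal e"
      by (intro add_right_mono SUP_upper) auto
    finally show "ereal (a' * u + b') \<le> (SUP n. ereal (a n * u + b n)) + ereal e" .
  qed
  have slope: "ereal a' \<le> (SUP n. ereal (a n))"
    if m: "\<And>u. u \<ge> 0 \<Longrightarrow> ereal (a' * u + b') \<le> f u" for a' b'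
  proof (rule ereal_le_epsilon2)
    fix e :: real assume "0 < e"
    then obtain n where "a' - e < a n" using approx_n[OF m] by blast
    then have "ereal a' \<le> ereal (a n) + ereal e" by simp
    also have "\<dots> \<le> (SUP n. ereal (a n)) + ereal e"
      by (intro add_right_mono SUP_upper) auto
    finally show "ereal a' \<le> (SUP n. ereal (a n)) + ereal e" .
  qed
  show thesis
  proof (rule that, intro allI impI)
    fix u :: real assume u: "u \<ge> 0"
    show "f u = (SUP n. ereal (a n * u + b n))"
    proof (rule antisym)
      show "f u \<le> (SUP n. ereal (a n * u + b n))"
      proof (cases "u = 0")
        case True
        show ?thesis
        proof (rule dense_le)
          fix c assume "c < f u"
          then obtain c' where c': "c < ereal c'" "ereal c' < f 0"
            using True ereal_dense2[of c] by blast
          obtain a' b' where "\<And>u. u \<ge> 0 \<Longrightarrow> ereal (a' * u + b') \<le> f u" "c' < b'"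
            using generator_minorant_at_zero[OF f c'(2)] by blast
          note \<open>c < ereal c'\<close>
          also have "ereal c' \<le> ereal (a' * u + b')" using \<open>c' < b'\<close> True by simp
          also have "\<dots> \<le> (SUP n. ereal (a n * u + b n))" by (rule ge) fact+
          finally show "c \<le> (SUP n. ereal (a n * u + b n))" by simp
        qed
      next
        case False
        then obtain a' b' where ab: "\<And>u. u \<ge> 0 \<Longrightarrow> ereal (a' * u + b') \<le> f u" "f u = ereal (a' * u + b')"
          using generator_subgradient[OF f, of u] u by auto
        show ?thesis unfolding ab(2) by (rule ge[OF ab(1) u])
      qed
    qed (use le[OF u] in \<open>auto intro: SUP_least\<close>)
  next
    let ?A = "SUP n. ereal (a n)"
    have "((\<lambda>u. f u / ereal u) \<longlongrightarrow> ?A) at_top"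
    proof (rule order_tendstoI)
      fix c assume "c < ?A"
      then obtain n where "c < ereal (a n)" by (auto simp: less_SUP_iff)
      then obtain c' where c': "c < ereal c'" "c' < a n" using ereal_dense2 by force
      have "((\<lambda>u. a n + b n / u) \<longlongrightarrow> a n + 0) at_top"
        by (intro tendsto_intros real_tendsto_divide_at_top[OF tendsto_const] filterlim_ident)
      then have "\<forall>\<^sub>F u in at_top. c' < a n + b n / u" using c' by (intro order_tendstoD) auto
      with eventually_gt_at_top[of 0] show "\<forall>\<^sub>F u in at_top. c < f u / ereal u"
      proof eventually_elim
        case (elim u)
        have "ereal (a n + b n / u) = ereal (a n * u + b n) / ereal u"
          using elim by (simp add: field_simps)
        also have "\<dots> \<le> f u / ereal u"
          using elim le[of u n] by (intro ereal_divide_right_mono) auto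
        finally show ?case using c'(1) elim by (meson ereal_less(2) less_ereal.simps(1) order.strict_trans order.strict_trans2)
      qed
    next
      fix c assume c: "?A < c"
      have "ereal (a 0) \<le> ?A" by (intro SUP_upper) auto
      then obtain A where A: "?A = ereal A" using c by (cases ?A) auto
      obtain c' where c': "A < c'" "ereal c' < c" using c ereal_dense2[of ?A c] A by auto
      have "((\<lambda>u. A - A / u) \<longlongrightarrow> A - 0) at_top"
        by (intro tendsto_intros real_tendsto_divide_at_top[OF tendsto_const] filterlim_ident)
      then have "\<forall>\<^sub>F u in at_top. A - A / u < c'" using c' by (intro order_tendstoD) auto
      \<comment> \<open>The tangent at \<open>u > 1\<close> is at most \<open>f 1 = 0\<close> at the
        point 1, so \<open>f u \<le> a' * (u - 1)\<close>, and \<open>a' \<le> A\<close>.\<close>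
      with eventually_gt_at_top[of 1] show "\<forall>\<^sub>F u in at_top. f u / ereal u < c"
      proof eventually_elim
        case (elim u)
        then obtain a' b' where ab: "\<And>u. u \<ge> 0 \<Longrightarrow> ereal (a' * u + b') \<le> f u" "f u = ereal (a' * u + b')"
          using generator_subgradient[OF f, of u] by auto
        have "a' + b' \<le> 0" using ab(1)[of 1] f by (simp add: divergence_generator_def)
        have "a' \<le> A" using slope[OF ab(1)] A by simp
        have "f u / ereal u = ereal ((a' * u + b') / u)" using ab(2) elim by simp
        also have "(a' * u + b') / u \<le> (a' * (u - 1)) / u"
          using \<open>a' + b' \<le> 0\<close> elim by (intro divide_right_mono) (auto simp: algebra_simps)
        also have "\<dots> \<le> (A * (u - 1)) / u"
          using \<open>a' \<le> A\<close> elim by (intro divide_right_mono mult_right_mono) auto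
        also have "\<dots> = A - A / u" using elim by (simp add: field_simps)
        also have "ereal \<dots> < ereal c'" using elim by simp
        finally show ?case using c'(2) by simp
      qed
    qed
    then show "f_infinity f = ?A"
      unfolding f_infinity_def by (intro tendsto_Lim) auto
  qed
qed

text \<open>Lower semicontinuity alone gives no upper control of \<open>f\<close> near
  \<open>t\<close>. Convexity on the segment from \<open>t\<close> to \<open>t + 1\<close> does, so
  rational points slightly to the right of \<open>t\<close> come arbitrarily close to its value;
  this also covers \<open>t = 0\<close>.\<close>

lemma scaled_conj_eq_SUP_Rats:
  assumes f: "divergence_generator f" and lam: "lam \<ge> 0"
  shows "scaled_conj f lam a = (SUP t\<in>{t \<in> \<rat>. 0 < t}. ereal (a * t - lam * real_of_ereal (f t)))"
    (is "_ = ?R")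
proof (rule antisym)
  have eq: "ereal (a * t) - ereal lam * f t = ereal (a * t - lam * real_of_ereal (f t))" if "t > 0" for t
    by (subst generator_finite[OF f that]) simp
  show "?R \<le> scaled_conj f lam a"
    unfolding scaled_conj_def
  proof (rule SUP_least)
    fix t :: real assume "t \<in> {t \<in> \<rat>. 0 < t}"
    then have t: "t > 0" by simp
    show "ereal (a * t - lam * real_of_ereal (f t)) \<le> (SUP t\<in>{0..}. ereal (a * t) - ereal lam * f t)"
      unfolding eq[OF t, symmetric] using t by (intro SUP_upper) auto
  qed
  show "scaled_conj f lam a \<le> ?R"
    unfolding scaled_conj_def
  proof (rule SUP_least)
    fix t :: real assume "t \<in> {0..}"
    then have t: "t \<ge> 0" by simp
    \<comment> \<open>For \<open>f t = \<infinity>\<close> and \<open>lam = 0\<close> this is the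
      default 0, which is harmless because \<open>w\<close> only occurs multiplied by
      \<open>lam\<close>.\<close>
    define w where "w = real_of_ereal (f t)"
    show "ereal (a * t) - ereal lam * f t \<le> ?R"
    proof (cases "f t = \<infinity> \<and> lam \<noteq> 0")
      case True
      then show ?thesis using lam by simp
    next
      case False
      have ft: "f t \<noteq> -\<infinity>" using f t by (auto simp: divergence_generator_def)
      have val: "ereal (a * t) - ereal lam * f t = ereal (a * t - lam * w)"
        using False ft by (cases "f t") (auto simp: w_def zero_ereal_def[symmetric])
      have bound: "lam * real_of_ereal (f (t + u)) \<le> lam * ((1 - u) * w + u * real_of_ereal (f (t + 1)))"
        if "0 < u" "u < 1" for u
      proof (cases "lam = 0")
        case nz: False
        then have ftw: "f t = ereal w" using False ft by (cases "f t") (auto simp: w_def)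
        have "f ((1 - u) * t + u * (t + 1)) \<le> ereal (1 - u) * f t + ereal u * f (t + 1)"
          using f t that by (auto simp: divergence_generator_def)
        moreover have "(1 - u) * t + u * (t + 1) = t + u" by (simp add: algebra_simps)
        ultimately have "f (t + u) \<le> ereal (1 - u) * f t + ereal u * f (t + 1)" by simp
        moreover have "f (t + u) = ereal (real_of_ereal (f (t + u)))"
          "f (t + 1) = ereal (real_of_ereal (f (t + 1)))"
          using t that by (auto intro!: generator_finite[OF f])
        ultimately have "real_of_ereal (f (t + u)) \<le> (1 - u) * w + u * real_of_ereal (f (t + 1))"
          unfolding ftw by (metis ereal_less_eq(3) plus_ereal.simps(1) times_ereal.simps(1))
        then show ?thesis using lam by (intro mult_left_mono)
      qed simp
      show ?thesis
        unfolding val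
      proof (rule ereal_le_epsilon2)
        fix e :: real assume e: "0 < e"
        let ?\<phi> = "\<lambda>u. a * (t + u) - lam * ((1 - u) * w + u * real_of_ereal (f (t + 1)))"
        have "(?\<phi> \<longlongrightarrow> a * (t + 0) - lam * ((1 - 0) * w + 0 * real_of_ereal (f (t + 1)))) (at_right 0)"
          by (intro tendsto_intros)
        then have "\<forall>\<^sub>F u in at_right 0. a * t - lam * w - e < ?\<phi> u"
          using e by (intro order_tendstoD) auto
        then obtain u0 where u0: "u0 > 0" "\<And>u. 0 < u \<Longrightarrow> u < u0 \<Longrightarrow> a * t - lam * w - e < ?\<phi> u"
          by (auto simp: eventually_at_right_field)
        obtain s where s: "s \<in> \<rat>" "t < s" "s < t + min u0 1"
          using Rats_dense_in_real[of t "t + min u0 1"] u0(1) by auto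
        have "a * t - lam * w - e < ?\<phi> (s - t)" using s by (intro u0(2)) auto
        also have "\<dots> \<le> a * s - lam * real_of_ereal (f s)"
          using bound[of "s - t"] s by simp
        finally have "ereal (a * t - lam * w) \<le> ereal (a * s - lam * real_of_ereal (f s)) + ereal e" by simp
        also have "\<dots> \<le> ?R + ereal e"
          using s t by (intro add_right_mono SUP_upper) auto
        finally show "ereal (a * t - lam * w) \<le> ?R + ereal e" .
      qed
    qed
  qed
qed

section \<open>The Lebesgue decomposition and the divergence\<close>

text \<open>The null set carrying the singular part is a \<open>P'\<close>-null set of maximal \<open>P\<close>-measure.\<close>

lemma lebesgue_decomposition_exists:
  assumes "finite_measure P" and sets: "sets P = sets P'"
  shows "\<exists>Pc Ps. lebesgue_decomposition P' P Pc Ps"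
proof -
  interpret P: finite_measure P by fact
  define \<N> where "\<N> = {A \<in> sets P. emeasure P' A = 0}"
  have ne: "measure P ` \<N> \<noteq> {}" by (auto simp: \<N>_def)
  have bdd: "bdd_above (measure P ` \<N>)"
    by (rule bdd_aboveI[of _ "measure P (space P)"]) (auto simp: P.bounded_measure)
  define s where "s = Sup (measure P ` \<N>)"
  have "\<exists>A\<in>\<N>. s - 1 / Suc n < measure P A" for n
  proof -
    have "s - 1 / Suc n < Sup (measure P ` \<N>)" by (simp add: s_def)
    then show ?thesis using less_cSup_iff[OF ne bdd] by auto
  qed
  then obtain A where A: "\<And>n. A n \<in> \<N>" "\<And>n. s - 1 / Suc n < measure P (A n)" by metis
  define Z where "Z = (\<Union>n. A n)"
  have ZP: "Z \<in> sets P" using A(1) by (auto simp: Z_def \<N>_def)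
  have ZP': "emeasure P' Z = 0"
    unfolding Z_def using A(1) sets by (intro emeasure_UN_eq_0) (auto simp: \<N>_def)
  have "s - 1 / Suc n < measure P Z" for n
    by (rule less_le_trans[OF A(2)], rule P.finite_measure_mono) (use ZP in \<open>auto simp: Z_def\<close>)
  moreover have "(\<lambda>n. s - 1 / Suc n) \<longlonglongrightarrow> s - 0"
    by (intro tendsto_intros LIMSEQ_Suc[OF lim_1_over_n])
  ultimately have "s \<le> measure P Z"
    by (intro LIMSEQ_le_const2[of "\<lambda>n. s - 1 / Suc n" s]) (auto intro: less_imp_le)
  \<comment> \<open>Otherwise \<open>C \<union> Z\<close> would be a \<open>P'\<close>-null set of
    \<open>P\<close>-measure above the supremum \<open>s\<close>.\<close>
  have max: "measure P (C - Z) = 0" if "C \<in> sets P" "emeasure P' C = 0" for C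
  proof -
    have "emeasure P' (C \<union> Z) = 0"
      using that ZP ZP' sets emeasure_subadditive[of C P' Z] by simp
    then have "C \<union> Z \<in> \<N>" using that ZP by (simp add: \<N>_def)
    then have "measure P (C \<union> Z) \<le> s" unfolding s_def by (intro cSup_upper bdd) auto
    moreover have "measure P (C \<union> Z) = measure P Z + measure P (C - Z)"
      using that ZP by (metis Un_commute P.finite_measure_Union' )
    ultimately show ?thesis
      using \<open>s \<le> measure P Z\<close> measure_nonneg[of P "C - Z"] by linarith
  qed
  have "lebesgue_decomposition P' P (density P (indicator (space P - Z))) (density P (indicator Z))"
    unfolding lebesgue_decomposition_def
  proof (intro conjI ballI)
    fix C assume C: "C \<in> sets P"
    have "emeasure P C = emeasure P ((space P - Z) \<inter> C) + emeasure P (Z \<inter> C)"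
      using C ZP sets.sets_into_space[OF C]
      by (subst plus_emeasure) (auto intro!: arg_cong[where f = "emeasure P"])
    then show "emeasure P C = emeasure (density P (indicator (space P - Z))) C
        + emeasure (density P (indicator Z)) C"
      using C ZP by (simp add: emeasure_restricted)
  next
    show "absolutely_continuous P' (density P (indicator (space P - Z)))"
      unfolding absolutely_continuous_def
    proof
      fix C assume "C \<in> null_sets P'"
      then have C: "C \<in> sets P" "emeasure P' C = 0" using sets by auto
      have "emeasure (density P (indicator (space P - Z))) C = emeasure P (C - Z)"
        using C ZP sets.sets_into_space[OF C(1)]
        by (subst emeasure_restricted) (auto intro!: arg_cong[where f = "emeasure P"])
      also have "\<dots> = 0" using max[OF C] by (simp add: P.emeasure_eq_measure)
      finally show "C \<in> null_sets (density P (indicator (space P - Z)))" using C by auto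
    qed
    show "\<exists>N\<in>sets P. emeasure P' N = 0 \<and> emeasure (density P (indicator Z)) (space P - N) = 0"
      using ZP ZP' by (intro bexI[of _ Z]) (auto simp: emeasure_restricted)
  qed auto
  then show ?thesis by blast
qed

text \<open>The choice inside \<open>f_divergence\<close> is opened once here and replaced by
  concrete data. The density can be real-valued because the absolutely continuous part is finite, so
  its derivative is finite almost everywhere.\<close>

lemma f_divergence_decomposition:
  assumes P: "finite_measure P" and P': "finite_measure P'" and sets: "sets P = sets P'"
  obtains h Z where "h \<in> borel_measurable P'" "\<forall>y. 0 \<le> h y" "Z \<in> sets P'" "emeasure P' Z = 0"
    "density P' (\<lambda>y. ennreal (h y)) = density P (indicator (space P - Z))"
    "\<forall>f. f_divergence f P' P = eintegral P' (\<lambda>y. f (h y)) + f_infinity f * ereal (measure P Z)"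
proof -
  interpret P: finite_measure P by fact
  interpret P': finite_measure P' by fact
  define PP where "PP = (SOME (Pc, Ps). lebesgue_decomposition P' P Pc Ps)"
  obtain Pc Ps where PP: "PP = (Pc, Ps)" by (cases PP)
  have dec: "lebesgue_decomposition P' P Pc Ps"
    using lebesgue_decomposition_exists[OF P sets]
      someI_ex[of "\<lambda>(Pc, Ps). lebesgue_decomposition P' P Pc Ps"] PP unfolding PP_def by auto
  then obtain Z where Z: "Z \<in> sets P" "emeasure P' Z = 0" "emeasure Ps (space P - Z) = 0"
    and s: "sets Pc = sets P" "sets Ps = sets P"
    and sum: "\<And>A. A \<in> sets P \<Longrightarrow> emeasure P A = emeasure Pc A + emeasure Ps A"
    and ac: "absolutely_continuous P' Pc"
    by (auto simp: lebesgue_decomposition_def)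
  have sp: "space Pc = space P" "space Ps = space P" "space P' = space P"
    using s sets by (metis sets_eq_imp_space_eq)+
  have Pc_Z: "emeasure Pc Z = 0"
    using ac Z sets by (auto simp: absolutely_continuous_def)
  have Pc: "Pc = density P (indicator (space P - Z))"
  proof (rule measure_eqI)
    fix A assume "A \<in> sets Pc"
    then have A: "A \<in> sets P" using s by simp
    have "emeasure Pc A \<le> emeasure Pc (A - Z) + emeasure Pc Z"
      using A Z s by (intro order_trans[OF emeasure_mono emeasure_subadditive]) auto
    then have 1: "emeasure Pc A = emeasure Pc (A - Z)"
      using A s by (simp add: Pc_Z antisym emeasure_mono)
    have "emeasure Ps (A - Z) \<le> emeasure Ps (space P - Z)"
      using A Z s sets.sets_into_space[OF A] by (intro emeasure_mono) auto
    then have "emeasure P (A - Z) = emeasure Pc (A - Z)"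
      using Z A by (simp add: sum)
    moreover have "(space P - Z) \<inter> A = A - Z" using sets.sets_into_space[OF A] by auto
    ultimately show "emeasure Pc A = emeasure (density P (indicator (space P - Z))) A"
      using 1 A Z by (simp add: emeasure_restricted)
  qed (use s in simp)
  have "emeasure Ps (space Ps) \<le> emeasure Ps (space P - Z) + emeasure Ps Z"
    using Z s sp sets.sets_into_space[OF Z(1)]
    by (intro order_trans[OF emeasure_mono emeasure_subadditive]) auto
  then have "emeasure Ps (space Ps) = emeasure Ps Z"
    using Z s sp sets.sets_into_space[OF Z(1)] by (simp add: antisym emeasure_mono)
  also have "\<dots> = emeasure P Z" using sum[OF Z(1)] Pc_Z by simp
  finally have \<sigma>: "measure Ps (space Ps) = measure P Z" by (simp add: measure_def)
  have "finite_measure Pc"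
    using sum[OF sets.top] P.emeasure_finite[of "space P"] sp
    by (intro finite_measureI) (auto simp: top_unique)
  then interpret Pc: finite_measure Pc .
  define h where "h y = enn2real (RN_deriv P' Pc y)" for y
  have "AE y in P'. RN_deriv P' Pc y \<noteq> \<infinity>"
    using P'.RN_deriv_finite[OF Pc.sigma_finite_measure ac] s sets by simp
  then have "AE y in P'. ennreal (h y) = RN_deriv P' Pc y"
    by eventually_elim (auto simp: h_def less_top)
  then have "density P' (\<lambda>y. ennreal (h y)) = density P' (RN_deriv P' Pc)"
    by (intro density_cong) (auto simp: h_def)
  also have "\<dots> = Pc" using P'.density_RN_deriv[OF ac] s sets by simp
  finally have "density P' (\<lambda>y. ennreal (h y)) = density P (indicator (space P - Z))"
    using Pc by simp
  moreover have "f_divergence f P' P = eintegral P' (\<lambda>y. f (h y)) + f_infinity f * ereal (measure P Z)" for f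
    by (simp add: f_divergence_def PP_def[symmetric] PP \<sigma> h_def)
  moreover have "h \<in> borel_measurable P'" unfolding h_def by measurable
  moreover have "\<forall>y. 0 \<le> h y" by (simp add: h_def)
  moreover have "Z \<in> sets P'" using Z sets by simp
  ultimately show thesis
    using Z(2) by (intro that[of h Z]) auto
qed

lemma integral_decomposition:
  fixes g :: "'a \<Rightarrow> real"
  assumes h: "h \<in> borel_measurable P'" "\<And>y. 0 \<le> h y"
    and Z: "Z \<in> sets P'" and sets: "sets P = sets P'"
    and dens: "density P' (\<lambda>y. ennreal (h y)) = density P (indicator (space P - Z))"
    and g: "integrable P g"
  shows "integrable P' (\<lambda>y. g y * h y)"
    and "(\<integral>y. g y \<partial>P) = (\<integral>y. g y * h y \<partial>P') + (\<integral>y. g y * indicator Z y \<partial>P)"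
proof -
  have ZP: "Z \<in> sets P" and gP: "g \<in> borel_measurable P" using Z sets g by auto
  have gP': "g \<in> borel_measurable P'" using gP measurable_cong_sets[OF sets refl] by blast
  have i1: "integrable P (\<lambda>y. g y * indicator (space P - Z) y)"
    and i2: "integrable P (\<lambda>y. g y * indicator Z y)"
    using g ZP by (auto intro: integrable_real_mult_indicator)
  have ind: "density P (indicator (space P - Z)) = density P (\<lambda>y. ennreal (indicator (space P - Z) y))"
    by (rule arg_cong[where f = "density P"]) (auto simp: indicator_def)
  have "integrable (density P (\<lambda>y. ennreal (indicator (space P - Z) y))) g"
    using i1 gP ZP by (subst integrable_density) (auto simp: mult.commute)
  then have "integrable (density P' (\<lambda>y. ennreal (h y))) g" using dens ind by simp
  then show "integrable P' (\<lambda>y. g y * h y)"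
    using h gP' by (subst (asm) integrable_density) (auto simp: mult.commute)
  have "(\<integral>y. g y * h y \<partial>P') = integral\<^sup>L (density P' (\<lambda>y. ennreal (h y))) g"
    using h gP' by (subst integral_density) (auto simp: mult.commute)
  also have "\<dots> = (\<integral>y. g y * indicator (space P - Z) y \<partial>P)"
    unfolding dens ind using gP ZP by (subst integral_density) (auto simp: mult.commute)
  finally have "(\<integral>y. g y * h y \<partial>P') + (\<integral>y. g y * indicator Z y \<partial>P)
      = (\<integral>y. g y * indicator (space P - Z) y + g y * indicator Z y \<partial>P)"
    using i1 i2 by simp
  also have "\<dots> = (\<integral>y. g y \<partial>P)"
    by (intro Bochner_Integration.integral_cong) (auto simp: indicator_def)
  finally show "(\<integral>y. g y \<partial>P) = (\<integral>y. g y * h y \<partial>P') + (\<integral>y. g y * indicator Z y \<partial>P)" ..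
qed

text \<open>Data processing: the densities \<open>p\<close> and \<open>q\<close> live on \<open>B\<close>, and \<open>F\<close> bounds the perspective
  \<open>q f (p/q)\<close>, which is \<open>f\<^sup>\<infinity> p\<close> where \<open>q = 0\<close>, through its affine minorants.  An almost optimal minorant
  is selected at each point of the image and pulled back along \<open>T\<close>.\<close>

lemma f_divergence_le:
  fixes a b :: "nat \<Rightarrow> real" and T :: "'a \<Rightarrow> 'b" and p q F :: "'a \<Rightarrow> real"
  assumes f: "\<And>u. u \<ge> 0 \<Longrightarrow> f u = (SUP n. ereal (a n * u + b n))"
    and finf: "f_infinity f = (SUP n. ereal (a n))"
    and T: "T \<in> measurable B N"
    and p: "integrable B p" "\<And>w. w \<in> space B \<Longrightarrow> 0 \<le> p w"
    and q: "integrable B q" "\<And>w. w \<in> space B \<Longrightarrow> 0 \<le> q w"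
    and P_def: "P = distr (density B (\<lambda>w. ennreal (p w))) N T" and P: "prob_space P"
    and Q_def: "Q = distr (density B (\<lambda>w. ennreal (q w))) N T" and Q: "prob_space Q"
    and F: "integrable B F" "\<And>n w. w \<in> space B \<Longrightarrow> a n * p w + b n * q w \<le> F w"
  shows "f_divergence f Q P \<le> ereal (\<integral>w. F w \<partial>B)"
proof -
  interpret P: prob_space P by fact
  interpret Q: prob_space Q by fact
  have setsP: "sets P = sets N" and setsQ: "sets Q = sets N" by (simp_all add: P_def Q_def)
  have setsPQ: "sets P = sets Q" by (simp add: setsP setsQ)
  obtain h Z where hm: "h \<in> borel_measurable Q" and h0: "\<forall>y. 0 \<le> h y"
    and Z: "Z \<in> sets Q" "emeasure Q Z = 0"
    and dens: "density Q (\<lambda>y. ennreal (h y)) = density P (indicator (space P - Z))"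
    and div_eq: "\<forall>f. f_divergence f Q P = eintegral Q (\<lambda>y. f (h y)) + f_infinity f * ereal (measure P Z)"
    by (rule f_divergence_decomposition[OF P.finite_measure_axioms Q.finite_measure_axioms setsPQ])
      (rule that)
  note h = hm h0[rule_format] and D = div_eq[rule_format]
  note dec = integral_decomposition[OF h Z(1) setsPQ dens]
  have h_int: "integrable Q h"
    using dec(1)[of "\<lambda>_. 1"] setsP setsQ by simp
  have [measurable]: "h \<in> borel_measurable Q" "Z \<in> sets Q" "p \<in> borel_measurable B"
    "q \<in> borel_measurable B" "T \<in> measurable B N"
    using h Z p q T by auto
  define \<sigma> where "\<sigma> = measure P Z"
  define g where "g n y = Max ((\<lambda>i. a i * h y + b i) ` {..n})" for n y
  define A where "A n = Max (a ` {..n})" for n :: nat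
  let ?c = "\<integral>w. F w \<partial>B"
  have Z_AE: "AE y in Q. y \<notin> Z" using Z by (intro AE_not_in) auto
  have key: "integrable Q (g n) \<and> (\<integral>y. g n y \<partial>Q) + A n * \<sigma> \<le> ?c" for n
  proof -
    \<comment> \<open>One index serves both parts of \<open>P\<close>: off \<open>Z\<close> it picks
      the best of the first minorants at \<open>h y\<close>, on \<open>Z\<close> the largest
      slope.\<close>
    have "(\<lambda>y. if y \<in> Z then a i else a i * h y + b i) \<in> borel_measurable Q" for i
      by measurable
    from measurable_argmax_index[of "\<lambda>i y. if y \<in> Z then a i else a i * h y + b i", OF this]
    obtain I where I: "I \<in> measurable Q (count_space UNIV)" "\<And>y. I y \<le> n"
      and max: "\<And>y i. i \<le> n \<Longrightarrow> (if y \<in> Z then a i else a i * h y + b i) \<le>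
        (if y \<in> Z then a (I y) else a (I y) * h y + b (I y))" by blast
    note [measurable] = I(1)
    have IN: "I \<in> measurable N (count_space UNIV)"
      using I(1) measurable_cong_sets[OF setsQ refl] by blast
    have IP: "I \<in> measurable P (count_space UNIV)"
      using IN measurable_cong_sets[OF setsP refl] by blast
    have bound: "\<bar>c (I y)\<bar> \<le> (\<Sum>i\<le>n. \<bar>c i\<bar>)" for y and c :: "nat \<Rightarrow> real"
      using I(2)[of y] by (intro member_le_sum) auto
    have wint: "integrable B (\<lambda>w. c (I (T w)) * r w)"
      if r: "integrable B r" "\<And>w. w \<in> space B \<Longrightarrow> 0 \<le> r w" for c :: "nat \<Rightarrow> real" and r
    proof (rule Bochner_Integration.integrable_bound)
      show "integrable B (\<lambda>w. (\<Sum>i\<le>n. \<bar>c i\<bar>) * r w)" using r by simp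
      have "(\<lambda>w. c (I (T w))) \<in> borel_measurable B" using IN by measurable
      then show "(\<lambda>w. c (I (T w)) * r w) \<in> borel_measurable B" using r by measurable
      show "AE w in B. norm (c (I (T w)) * r w) \<le> norm ((\<Sum>i\<le>n. \<bar>c i\<bar>) * r w)"
        using bound[of c] r by (intro AE_I2) (auto simp: abs_mult intro!: mult_right_mono order_trans[OF bound])
    qed
    have intP: "integrable P (\<lambda>y. a (I y))"
      using bound IP by (intro P.integrable_const_bound[of _ "\<Sum>i\<le>n. \<bar>a i\<bar>"]) auto
    have intQ: "integrable Q (\<lambda>y. b (I y))"
      using bound by (intro Q.integrable_const_bound[of _ "\<Sum>i\<le>n. \<bar>b i\<bar>"]) auto
    note dec_a = dec[OF intP]
    have g_AE: "AE y in Q. g n y = a (I y) * h y + b (I y)"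
      using Z_AE
    proof eventually_elim
      case (elim y)
      show ?case
        unfolding g_def using max[of _ y] elim I(2)[of y] by (intro Max_eqI) auto
    qed
    have gm: "g n \<in> borel_measurable Q" unfolding g_def by (intro borel_measurable_Max) auto
    have gi: "integrable Q (g n)" "(\<integral>y. g n y \<partial>Q) = (\<integral>y. a (I y) * h y \<partial>Q) + (\<integral>y. b (I y) \<partial>Q)"
    proof -
      have "integrable Q (\<lambda>y. a (I y) * h y + b (I y))" using dec_a(1) intQ by simp
      then show "integrable Q (g n)" using g_AE gm by (subst integrable_cong_AE) auto
      have "(\<integral>y. g n y \<partial>Q) = (\<integral>y. a (I y) * h y + b (I y) \<partial>Q)"
        using g_AE gm by (intro integral_cong_AE) auto
      then show "(\<integral>y. g n y \<partial>Q) = (\<integral>y. a (I y) * h y \<partial>Q) + (\<integral>y. b (I y) \<partial>Q)"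
        using dec_a(1) intQ by simp
    qed
    have "a (I y) = A n" if "y \<in> Z" for y
      unfolding A_def using max[of _ y] that I(2)[of y] by (intro Max_eqI[symmetric]) auto
    then have "(\<integral>y. a (I y) * indicator Z y \<partial>P) = (\<integral>y. A n * indicator Z y \<partial>P)"
      by (intro Bochner_Integration.integral_cong) (auto simp: indicator_def)
    also have "\<dots> = A n * \<sigma>" using Z setsP setsQ by (simp add: \<sigma>_def)
    \<comment> \<open>Regular and singular parts recombine into slopes integrated against
      \<open>P\<close> and intercepts against \<open>Q\<close>. This form is linear in the two
      densities, so it can be pulled back along \<open>T\<close>, where \<open>F\<close> dominates
      pointwise.\<close>
    finally have "(\<integral>y. g n y \<partial>Q) + A n * \<sigma> = (\<integral>y. a (I y) \<partial>P) + (\<integral>y. b (I y) \<partial>Q)"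
      using gi dec_a(2) by simp
    also have "(\<integral>y. a (I y) \<partial>P) = (\<integral>w. a (I (T w)) * p w \<partial>B)"
      unfolding P_def using IN p by (subst integral_distr) (auto simp: integral_density mult.commute)
    also have "(\<integral>y. b (I y) \<partial>Q) = (\<integral>w. b (I (T w)) * q w \<partial>B)"
      unfolding Q_def using IN q by (subst integral_distr) (auto simp: integral_density mult.commute)
    also have "(\<integral>w. a (I (T w)) * p w \<partial>B) + (\<integral>w. b (I (T w)) * q w \<partial>B)
        = (\<integral>w. a (I (T w)) * p w + b (I (T w)) * q w \<partial>B)"
      using wint[of p a] wint[of q b] p q by (intro Bochner_Integration.integral_add[symmetric]) auto
    also have "\<dots> \<le> ?c"
      using F wint[of p a] wint[of q b] p q by (intro integral_mono) auto
    finally show ?thesis using gi by simp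
  qed
  have g_mono: "g m y \<le> g n y" if "m \<le> n" for m n y
    unfolding g_def using that by (intro Max_mono) auto
  have A_mono: "A m \<le> A n" if "m \<le> n" for m n
    unfolding A_def using that by (intro Max_mono) auto
  have f_SUP: "f (h y) = (SUP n. ereal (g n y))" for y
  proof -
    have "(SUP n. ereal (a n * h y + b n)) = (SUP n. ereal (g n y))"
    proof (rule SUP_eq)
      fix n
      show "\<exists>m\<in>UNIV. ereal (a n * h y + b n) \<le> ereal (g m y)"
        by (intro bexI[of _ n]) (auto simp: g_def)
      have "g n y \<in> (\<lambda>i. a i * h y + b i) ` {..n}" unfolding g_def by (intro Max_in) auto
      then show "\<exists>m\<in>UNIV. ereal (g n y) \<le> ereal (a m * h y + b m)" by auto
    qed
    then show ?thesis using f[OF h(2)] by simp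
  qed
  have fm: "(\<lambda>y. f (h y)) \<in> borel_measurable Q"
    unfolding f[OF h(2)] by measurable
  \<comment> \<open>The index \<open>max m k\<close> decouples the two limits: \<open>m\<close> can
    go to infinity in the regular part while \<open>k\<close> stays fixed in the singular
    part.\<close>
  have upper: "eintegral Q (\<lambda>y. f (h y)) \<le> ereal (?c - A k * \<sigma>)" for k
  proof (rule eintegral_SUP_le)
    show "(\<integral>y. g m y \<partial>Q) \<le> ?c - A k * \<sigma>" for m
    proof -
      have "(\<integral>y. g m y \<partial>Q) \<le> (\<integral>y. g (max m k) y \<partial>Q)"
        using key by (intro integral_mono g_mono) auto
      moreover have "A k * \<sigma> \<le> A (max m k) * \<sigma>"
        by (intro mult_right_mono A_mono) (auto simp: \<sigma>_def)
      ultimately show ?thesis using key[of "max m k"] by linarith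
    qed
  qed (use key g_mono f_SUP in auto)
  have "ereal (\<integral>y. g 0 y \<partial>Q) \<le> eintegral Q (\<lambda>y. f (h y))"
    using key by (intro eintegral_ge fm) (auto simp: f_SUP intro: SUP_upper)
  then obtain e where e: "eintegral Q (\<lambda>y. f (h y)) = ereal e"
    using upper[of 0] by (cases "eintegral Q (\<lambda>y. f (h y))") auto
  \<comment> \<open>Without singular mass the slopes are not bounded by the estimate and
    \<open>f_infinity f\<close> may be infinite, so that case rests on the product with 0 being
    0.\<close>
  have "f_infinity f * ereal \<sigma> \<le> ereal (?c - e)"
  proof (cases "\<sigma> = 0")
    case True
    then have "f_infinity f * ereal \<sigma> = ereal 0" by (simp flip: zero_ereal_def)
    then show ?thesis using upper[of 0] e True by simp
  next
    case False
    then have "\<sigma> > 0" by (simp add: \<sigma>_def zero_less_measure_iff)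
    have "a n \<le> (?c - e) / \<sigma>" for n
    proof -
      have "a n * \<sigma> \<le> A n * \<sigma>" using \<open>\<sigma> > 0\<close> by (simp add: A_def)
      then have "a n * \<sigma> \<le> ?c - e" using upper[of n] e by simp
      then show ?thesis using \<open>\<sigma> > 0\<close> by (simp add: pos_le_divide_eq)
    qed
    then have "f_infinity f \<le> ereal ((?c - e) / \<sigma>)"
      unfolding finf by (auto intro: SUP_least)
    then have "f_infinity f * ereal \<sigma> \<le> ereal ((?c - e) / \<sigma>) * ereal \<sigma>"
      using \<open>\<sigma> > 0\<close> by (intro ereal_mult_right_mono) auto
    then show ?thesis using \<open>\<sigma> > 0\<close> by simp
  qed
  then have "f_divergence f Q P \<le> ereal e + ereal (?c - e)"
    unfolding D e \<sigma>_def[symmetric] by (intro add_left_mono)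
  then show ?thesis by simp
qed

section \<open>Weak duality\<close>

lemma integrable_compose_index:
  fixes c :: "nat \<Rightarrow> 'a \<Rightarrow> real"
  assumes c: "\<And>i. integrable M (c i)" and I: "I \<in> measurable M (count_space UNIV)"
    and n: "\<And>x. x \<in> space M \<Longrightarrow> I x \<le> n"
  shows "integrable M (\<lambda>x. c (I x) x)"
proof (rule Bochner_Integration.integrable_bound)
  show "integrable M (\<lambda>x. \<Sum>i\<le>n. \<bar>c i x\<bar>)" using c by auto
  show "(\<lambda>x. c (I x) x) \<in> borel_measurable M"
    by (rule measurable_compose_countable[OF _ I]) (use c in auto)
  show "AE x in M. norm (c (I x) x) \<le> norm (\<Sum>i\<le>n. \<bar>c i x\<bar>)"
  proof (rule AE_I2)
    fix x assume "x \<in> space M"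
    then have "\<bar>c (I x) x\<bar> \<le> (\<Sum>i\<le>n. \<bar>c i x\<bar>)"
      using n by (intro member_le_sum[of _ _ "\<lambda>i. \<bar>c i x\<bar>"]) auto
    then show "norm (c (I x) x) \<le> norm (\<Sum>i\<le>n. \<bar>c i x\<bar>)" by simp
  qed
qed

text \<open>The product acts as a disjoint union of finitely many copies of \<open>M\<close>; it is
  the sample space on which mixtures are realised.\<close>

lemma integral_count_space_pair:
  fixes g :: "'i \<Rightarrow> 'a \<Rightarrow> real"
  assumes "finite A" "finite_measure M" and g: "\<And>j. j \<in> A \<Longrightarrow> integrable M (g j)"
  shows "integrable (count_space A \<Otimes>\<^sub>M M) (\<lambda>w. g (fst w) (snd w))"
    and "(\<integral>w. g (fst w) (snd w) \<partial>(count_space A \<Otimes>\<^sub>M M)) = (\<Sum>j\<in>A. \<integral>x. g j x \<partial>M)"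
proof -
  interpret M: finite_measure M by fact
  interpret C: sigma_finite_measure "count_space A"
    using \<open>finite A\<close> by (intro sigma_finite_measure_count_space_finite)
  interpret pair_sigma_finite "count_space A" M ..
  have m: "(\<lambda>w. g (fst w) (snd w)) \<in> borel_measurable (count_space A \<Otimes>\<^sub>M M)"
    by (rule measurable_pair_measure_countable1) (use assms in \<open>auto intro: countable_finite\<close>)
  show int: "integrable (count_space A \<Otimes>\<^sub>M M) (\<lambda>w. g (fst w) (snd w))"
    by (rule Fubini_integrable[OF m])
      (use assms in \<open>auto intro!: integrable_count_space AE_I2\<close>)
  have "(\<integral>w. g (fst w) (snd w) \<partial>(count_space A \<Otimes>\<^sub>M M)) = (\<integral>j. (\<integral>x. g j x \<partial>M) \<partial>count_space A)"
    using integral_fst'[OF int] by simp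
  also have "\<dots> = (\<Sum>j\<in>A. \<integral>x. g j x \<partial>M)"
    using \<open>finite A\<close> by (rule lebesgue_integral_count_space_finite)
  finally show "(\<integral>w. g (fst w) (snd w) \<partial>(count_space A \<Otimes>\<^sub>M M)) = (\<Sum>j\<in>A. \<integral>x. g j x \<partial>M)" .
qed

section \<open>Measurability and selections on the compact support, and the dual bound along a
  coupling\<close>

locale transport_setting =
  fixes S :: "'a::euclidean_space set" and f :: "real \<Rightarrow> ereal" and d :: "'a \<Rightarrow> 'a \<Rightarrow> real"
    and l :: "'x \<Rightarrow> 'a \<Rightarrow> real" and x :: 'x and Phat :: "'a measure"
  assumes S: "compact S"
    and f: "divergence_generator f"
    and d_nonneg: "\<And>y z. y \<in> S \<Longrightarrow> z \<in> S \<Longrightarrow> 0 \<le> d y z"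
    and d_lsc: "lsc_on (S \<times> S) (\<lambda>(y, z). d y z)"
    and d_refl: "\<And>y. y \<in> S \<Longrightarrow> d y y = 0"
    and l_range: "\<And>y. y \<in> S \<Longrightarrow> 0 \<le> l x y \<and> l x y \<le> loss_sup S l x"
    and l_usc: "usc_on S (l x)"
    and Phat: "Phat \<in> borel_probs S"
begin

abbreviation BS :: "'a measure" where "BS \<equiv> restrict_space borel S"

sublocale Phat: prob_space Phat
  using Phat by (simp add: borel_probs_def)

lemma sets_Phat: "sets Phat = sets BS"
  using Phat by (simp add: borel_probs_def)

lemma space_Phat: "space Phat = S"
  using sets_eq_imp_space_eq[OF sets_Phat] by (simp add: space_restrict_space)

lemma S_nonempty: "S \<noteq> {}"
  using Phat.not_empty space_Phat by simp

text \<open>The sign is reversed because the selection theorem minimises.\<close>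

lemma closed_l_superlevel: "closed {y \<in> S. - l x y \<le> c}"
proof -
  have "closedin (top_of_set S) {y \<in> S. - c \<le> l x y}"
    by (rule closedin_superlevel[OF l_usc])
  moreover have "{y \<in> S. - c \<le> l x y} = {y \<in> S. - l x y \<le> c}" by auto
  ultimately show ?thesis using closedin_closed_trans S compact_imp_closed by metis
qed

lemma closed_d_sublevel: "closed {z \<in> S \<times> S. d (fst z) (snd z) \<le> c}"
  using closedin_closed_trans[OF closedin_sublevel[OF d_lsc, of c]] S
  by (simp add: compact_imp_closed compact_Times case_prod_beta)

lemma l_measurable [measurable]: "l x \<in> borel_measurable BS"
proof -
  have "(\<lambda>y. - l x y) \<in> borel_measurable BS"
  proof (rule borel_measurableI_le)
    fix c
    have "{y \<in> space BS. - l x y \<le> c} = {y \<in> S. - l x y \<le> c}"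
      by (simp add: space_restrict_space)
    also have "\<dots> \<in> sets BS"
      using closed_l_superlevel[of c] by (subst sets_restrict_space_iff) (auto simp: S compact_imp_closed)
    finally show "{y \<in> space BS. - l x y \<le> c} \<in> sets BS" .
  qed
  then show ?thesis by simp
qed

lemma d_measurable: "(\<lambda>z. d (fst z) (snd z)) \<in> borel_measurable (BS \<Otimes>\<^sub>M BS)"
proof (rule borel_measurableI_le)
  fix c
  have id: "(\<lambda>z. z) \<in> measurable BS borel"
    by (simp add: measurable_restrict_space1)
  have "(\<lambda>z. (fst z, snd z)) \<in> measurable (BS \<Otimes>\<^sub>M BS) (borel \<Otimes>\<^sub>M borel)"
    by (intro measurable_Pair measurable_compose[OF measurable_fst id]
        measurable_compose[OF measurable_snd id])
  then have "(\<lambda>z. z) \<in> measurable (BS \<Otimes>\<^sub>M BS) borel" by (simp add: borel_prod)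
  from measurable_sets[OF this, of "{z \<in> S \<times> S. d (fst z) (snd z) \<le> c}"]
  have "{z \<in> S \<times> S. d (fst z) (snd z) \<le> c} \<inter> space (BS \<Otimes>\<^sub>M BS) \<in> sets (BS \<Otimes>\<^sub>M BS)"
    using closed_d_sublevel[of c] by simp
  also have "{z \<in> S \<times> S. d (fst z) (snd z) \<le> c} \<inter> space (BS \<Otimes>\<^sub>M BS)
      = {z \<in> space (BS \<Otimes>\<^sub>M BS). d (fst z) (snd z) \<le> c}"
    by (auto simp: space_pair_measure space_restrict_space)
  finally show "{z \<in> space (BS \<Otimes>\<^sub>M BS). d (fst z) (snd z) \<le> c} \<in> sets (BS \<Otimes>\<^sub>M BS)" .
qed

lemma loss_sup_attained: "\<exists>y\<in>S. l x y = loss_sup S l x"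
proof -
  obtain y where y: "y \<in> S" "\<And>z. z \<in> S \<Longrightarrow> - l x y \<le> - l x z"
    using argmin_nonempty[OF S S_nonempty closed_l_superlevel] by blast
  then have "loss_sup S l x \<le> l x y"
    unfolding loss_sup_def by (intro cSUP_least[OF S_nonempty]) auto
  then show ?thesis using l_range[OF y(1)] y(1) by (intro bexI[of _ y]) auto
qed

text \<open>Lower semicontinuity of \<open>d\<close> makes the graph compact; its sections are the
  values, and the set of centres whose ball hits \<open>F\<close> is a compact projection, hence
  Borel. A ball is nonempty because it contains its centre.\<close>

lemma d_ball_correspondence:
  assumes "\<delta> \<ge> 0"
  shows "measurable_correspondence BS (\<lambda>y. {z \<in> S. d y z \<le> \<delta>})"
proof -
  let ?C = "{z \<in> S \<times> S. d (fst z) (snd z) \<le> \<delta>}"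
  have C: "compact ?C"
    using compact_Int_closed[OF compact_Times[OF S S] closed_d_sublevel[of \<delta>]]
    by (simp add: Collect_conj_eq Int_assoc[symmetric])
  show ?thesis
    unfolding measurable_correspondence_def
  proof (intro conjI ballI allI impI)
    fix y assume "y \<in> space BS"
    then have y: "y \<in> S" by (simp add: space_restrict_space)
    show "{z \<in> S. d y z \<le> \<delta>} \<noteq> {}" using y d_refl assms by auto
    have "{z \<in> S. d y z \<le> \<delta>} = snd ` (?C \<inter> {y} \<times> UNIV)" using y by force
    also have "compact \<dots>"
      using C by (intro compact_continuous_image compact_Int_closed closed_Times continuous_intros) auto
    finally show "compact {z \<in> S. d y z \<le> \<delta>}" .
  next
    fix F :: "'a set" assume F: "closed F"
    have "{y \<in> space BS. {z \<in> S. d y z \<le> \<delta>} \<inter> F \<noteq> {}} = fst ` (?C \<inter> UNIV \<times> F)"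
      by (force simp: space_restrict_space)
    also have "compact \<dots>"
      using C F by (intro compact_continuous_image compact_Int_closed closed_Times continuous_intros) auto
    then have "fst ` (?C \<inter> UNIV \<times> F) \<in> sets borel" by (simp add: compact_imp_closed)
    then have "fst ` (?C \<inter> UNIV \<times> F) \<in> sets BS"
      using S by (subst sets_restrict_space_iff) (auto simp: compact_imp_closed)
    finally show "{y \<in> space BS. {z \<in> S. d y z \<le> \<delta>} \<inter> F \<noteq> {}} \<in> sets BS" .
  qed
qed

text \<open>The supremum in the inflated loss is attained at all points by a single Borel map. This
  map is the transport of a primal strategy, and it also makes the inflated loss measurable.\<close>

lemma loss_inflated_selection:
  assumes "\<delta> \<ge> 0"
  shows "\<exists>T\<in>measurable BS BS. \<forall>y\<in>S. d y (T y) \<le> \<delta> \<and> l x (T y) = loss_inflated S d l \<delta> x y"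
proof -
  have clS: "closed S" using S by (rule compact_imp_closed)
  obtain T where T: "T \<in> borel_measurable BS"
    "\<And>y. y \<in> S \<Longrightarrow> T y \<in> {z \<in> S. d y z \<le> \<delta>}"
    "\<And>y z. y \<in> S \<Longrightarrow> z \<in> {z \<in> S. d y z \<le> \<delta>} \<Longrightarrow> - l x (T y) \<le> - l x z"
    using measurable_argmin_selection[OF d_ball_correspondence[OF assms] _ clS closed_l_superlevel]
    by (auto simp: space_restrict_space)
  have "T \<in> measurable BS BS"
    using T(1,2) by (intro measurable_restrict_space2) (auto simp: space_restrict_space)
  moreover have "l x (T y) = loss_inflated S d l \<delta> x y" if "y \<in> S" for y
    unfolding loss_inflated_def using T(2,3)[OF that] by (intro cSup_eq_maximum[symmetric]) auto
  ultimately show ?thesis using T(2) by blast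
qed

lemma loss_inflated_ge:
  assumes "y \<in> S" "z \<in> S" "d y z \<le> \<delta>"
  shows "l x z \<le> loss_inflated S d l \<delta> x y"
  unfolding loss_inflated_def
  using assms l_range by (intro cSUP_upper bdd_aboveI2[of _ _ "loss_sup S l x"]) auto


text \<open>The hypothesis \<open>le\<close> is dual feasibility for a pair of start and end points.
  Fenchel's inequality at the likelihood ratio of \<open>P\<close> to \<open>Q\<close> is integrated
  along \<open>\<pi>\<close>; the part of \<open>P\<close> singular to \<open>Q\<close> is paid for
  by \<open>feas\<close>.\<close>

lemma dual_bound_of_coupling:
  fixes G :: "'a \<Rightarrow> ereal"
  assumes P: "P \<in> borel_probs S" and Q: "Q \<in> borel_probs S" and \<pi>: "\<pi> \<in> couplings Phat Q"
    and cost: "(\<integral>\<^sup>+z. ennreal (d (fst z) (snd z)) \<partial>\<pi>) \<le> ennreal \<epsilon>" "0 \<le> \<epsilon>"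
    and div: "f_divergence f Q P \<le> ereal r"
    and lam: "0 \<le> lam" and \<gamma>: "0 \<le> \<gamma>" and \<rho>: "0 \<le> \<rho>"
    and feas: "f_infinity f = \<infinity> \<or> ereal (loss_sup S l x - \<eta>) \<le> f_infinity f * ereal lam"
    and G: "G \<in> borel_measurable Phat" "\<And>y. y \<in> S \<Longrightarrow> ereal g0 \<le> G y" "eintegral Phat G = ereal V"
    and le: "\<And>y z. y \<in> S \<Longrightarrow> z \<in> S \<Longrightarrow>
      scaled_conj f lam (l x z - \<eta>) \<le> G y + ereal (\<gamma> * (\<rho> * d y z + \<beta>))"
  shows "(\<integral>y. l x y \<partial>P) \<le> V + lam * r + \<eta> + \<gamma> * (\<rho> * \<epsilon> + \<beta>)"
proof -
  have setsP: "sets P = sets BS" and setsQ: "sets Q = sets BS"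
    using P Q by (auto simp: borel_probs_def)
  have setsPQ: "sets P = sets Q" by (simp add: setsP setsQ)
  have spP: "space P = S" "space Q = S"
    using setsP setsQ by (auto dest!: sets_eq_imp_space_eq simp: space_restrict_space)
  interpret P: prob_space P using P by (simp add: borel_probs_def)
  interpret Q: prob_space Q using Q by (simp add: borel_probs_def)
  interpret \<pi>: prob_space \<pi> using \<pi> by (simp add: couplings_def)
  have sets\<pi>: "sets \<pi> = sets (Phat \<Otimes>\<^sub>M Q)" using \<pi> by (simp add: couplings_def)
  have sp\<pi>: "space \<pi> = S \<times> S"
    using sets_eq_imp_space_eq[OF sets\<pi>] by (simp add: space_pair_measure space_Phat spP)
  have fst_m: "fst \<in> measurable \<pi> Phat" and snd_m: "snd \<in> measurable \<pi> Q"
    using measurable_cong_sets[OF sets\<pi> refl] measurable_fst measurable_snd by blast+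
  have fst_d: "distr \<pi> Phat fst = Phat" and snd_d: "distr \<pi> Q snd = Q"
    using \<pi> by (auto simp: couplings_def)
  obtain a b :: "nat \<Rightarrow> real" where ab0: "\<forall>u\<ge>0. f u = (SUP n. ereal (a n * u + b n))"
    and finf: "f_infinity f = (SUP n. ereal (a n))"
    using generator_minorants[OF f] by blast
  note ab = ab0[rule_format]
  obtain h Z where hm: "h \<in> borel_measurable Q" and h0: "\<forall>y. 0 \<le> h y"
    and Z: "Z \<in> sets Q" "emeasure Q Z = 0"
    and dens: "density Q (\<lambda>y. ennreal (h y)) = density P (indicator (space P - Z))"
    and div_eq: "\<forall>f. f_divergence f Q P = eintegral Q (\<lambda>y. f (h y)) + f_infinity f * ereal (measure P Z)"
    by (rule f_divergence_decomposition[OF P.finite_measure_axioms Q.finite_measure_axioms setsPQ])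
      (rule that)
  note h = hm h0[rule_format] and D = div_eq[rule_format]
  note dec = integral_decomposition[OF h Z(1) setsPQ dens]
  define \<sigma> where "\<sigma> = measure P Z"
  define L where "L = loss_sup S l x"
  have \<sigma>: "0 \<le> \<sigma>" by (simp add: \<sigma>_def)
  have lP: "l x \<in> borel_measurable P" "l x \<in> borel_measurable Q"
    using l_measurable measurable_cong_sets[OF setsP refl] measurable_cong_sets[OF setsQ refl] by blast+
  have l_int: "integrable P (l x)"
    using lP l_range by (intro P.integrable_const_bound[of _ L] AE_I2) (auto simp: spP L_def)
  have h_int: "integrable Q h" and h_mass: "(\<integral>y. h y \<partial>Q) = 1 - \<sigma>"
    using dec[of "\<lambda>_. 1"] Z setsP setsQ P.prob_space by (auto simp: \<sigma>_def)
  have lh_int: "integrable Q (\<lambda>y. l x y * h y)" using dec(1)[OF l_int] .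
  have fm: "(\<lambda>y. f (h y)) \<in> borel_measurable Q"
    unfolding ab[OF h(2)] using h(1) by measurable
  have minor: "ereal (a 0 * h y + b 0) \<le> f (h y)" for y
    unfolding ab[OF h(2)] by (intro SUP_upper) auto
  have minor_int: "integrable Q (\<lambda>y. a 0 * h y + b 0)" using h_int by simp
  have e_ge: "ereal (\<integral>y. a 0 * h y + b 0 \<partial>Q) \<le> eintegral Q (\<lambda>y. f (h y))"
    using minor by (intro eintegral_ge fm minor_int)
  have a0: "ereal (a 0) \<le> f_infinity f" unfolding finf by (intro SUP_upper) auto
  have "ereal (a 0) * ereal \<sigma> \<le> f_infinity f * ereal \<sigma>"
    using a0 \<sigma> by (intro ereal_mult_right_mono) auto
  then have s_ge: "ereal (a 0 * \<sigma>) \<le> f_infinity f * ereal \<sigma>" by simp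
  have sum: "eintegral Q (\<lambda>y. f (h y)) + f_infinity f * ereal \<sigma> \<le> ereal r"
    using div unfolding D \<sigma>_def .
  \<comment> \<open>The minorant with index 0 bounds both summands of the divergence below by reals,
    so the upper bound \<open>r\<close> makes both of them real.\<close>
  obtain E where E: "eintegral Q (\<lambda>y. f (h y)) = ereal E"
    using e_ge s_ge sum by (cases "eintegral Q (\<lambda>y. f (h y))"; cases "f_infinity f * ereal \<sigma>") auto
  obtain W where W: "f_infinity f * ereal \<sigma> = ereal W"
    using s_ge sum E by (cases "f_infinity f * ereal \<sigma>") auto
  have EW: "E + W \<le> r" using sum E W by simp
  define Fh where "Fh y = real_of_ereal (f (h y))" for y
  have fin: "eintegral Q (\<lambda>y. f (h y)) \<noteq> \<infinity>" using E by simp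
  note fh = eintegral_finite[OF fm minor_int minor fin, folded Fh_def]
  have E_eq: "E = (\<integral>y. Fh y \<partial>Q)" using fh(3) E by simp
  define Gr where "Gr y = real_of_ereal (G y)" for y
  have G2: "\<And>y. y \<in> space Phat \<Longrightarrow> ereal g0 \<le> G y" using G(2) by (simp add: space_Phat)
  have finG: "eintegral Phat G \<noteq> \<infinity>" using G(3) by simp
  note gr = eintegral_finite[OF G(1) _ G2 finG, folded Gr_def, simplified]
  have V_eq: "V = (\<integral>y. Gr y \<partial>Phat)" using gr(3) G(3) by simp
  \<comment> \<open>If \<open>\<sigma> > 0\<close>, the real product \<open>W\<close> forces
    \<open>f_infinity f\<close> to be finite, so the constraint is not void and can be multiplied by
    \<open>\<sigma>\<close>.\<close>
  have sing: "(L - \<eta>) * \<sigma> \<le> lam * W"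
  proof (cases "\<sigma> = 0")
    case True
    then have "ereal W = 0" using W by (simp flip: zero_ereal_def)
    then show ?thesis using True by simp
  next
    case False
    then have pos: "\<sigma> > 0" using \<sigma> by simp
    then obtain w where w: "f_infinity f = ereal w"
      using W a0 by (cases "f_infinity f") auto
    then have "L - \<eta> \<le> w * lam" using feas by (simp add: L_def)
    moreover have "W = w * \<sigma>" using W w by simp
    ultimately show ?thesis using mult_right_mono[of "L - \<eta>" "w * lam" \<sigma>] \<sigma> by (simp add: mult_ac)
  qed
  have d_m: "(\<lambda>z. d (fst z) (snd z)) \<in> borel_measurable \<pi>"
    using d_measurable sets\<pi> sets_pair_measure_cong[OF sets_Phat setsQ] measurable_cong_sets by blast
  have d_int: "integrable \<pi> (\<lambda>z. d (fst z) (snd z))"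
    using d_m cost d_nonneg by (intro integrableI_nonneg AE_I2) (auto simp: sp\<pi> intro: order.strict_trans1)
  have "ennreal (\<integral>z. d (fst z) (snd z) \<partial>\<pi>) \<le> ennreal \<epsilon>"
    using cost(1) d_nonneg by (subst nn_integral_eq_integral[OF d_int, symmetric]) (auto simp: sp\<pi>)
  then have d_le: "(\<integral>z. d (fst z) (snd z) \<partial>\<pi>) \<le> \<epsilon>"
    using cost(2) by simp
  have AE_G: "AE z in \<pi>. ereal (Gr (fst z)) = G (fst z)"
    by (rule AE_distrD[OF fst_m]) (unfold fst_d, rule gr(2))
  have AE_f: "AE z in \<pi>. ereal (Fh (snd z)) = f (h (snd z))"
    by (rule AE_distrD[OF snd_m]) (unfold snd_d, rule fh(2))
  \<comment> \<open>This is the conjugate's expression at the trial value \<open>h y\<close>, hence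
    at most \<open>scaled_conj f lam (l x y - \<eta>)\<close>.\<close>
  define k where "k y = (l x y - \<eta>) * h y - lam * Fh y" for y
  have k_int: "integrable Q k"
    unfolding k_def using lh_int h_int fh(1) by (simp add: left_diff_distrib)
  have AE_le: "AE z in \<pi>. k (snd z) \<le> Gr (fst z) + \<gamma> * (\<rho> * d (fst z) (snd z) + \<beta>)"
  proof (rule AE_mp[OF AE_conjI[OF AE_G AE_f] AE_I2[OF impI]])
    fix z assume "z \<in> space \<pi>"
    then have z: "fst z \<in> S" "snd z \<in> S" by (auto simp: sp\<pi>)
    assume eq: "ereal (Gr (fst z)) = G (fst z) \<and> ereal (Fh (snd z)) = f (h (snd z))"
    have "ereal (k (snd z)) = ereal ((l x (snd z) - \<eta>) * h (snd z)) - ereal lam * f (h (snd z))"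
      using eq by (simp add: k_def flip: eq)
    also have "\<dots> \<le> scaled_conj f lam (l x (snd z) - \<eta>)"
      unfolding scaled_conj_def using h(2) by (intro SUP_upper) auto
    also have "\<dots> \<le> G (fst z) + ereal (\<gamma> * (\<rho> * d (fst z) (snd z) + \<beta>))"
      by (rule le[OF z])
    also have "\<dots> = ereal (Gr (fst z) + \<gamma> * (\<rho> * d (fst z) (snd z) + \<beta>))"
      using eq by (metis plus_ereal.simps(1))
    finally show "k (snd z) \<le> Gr (fst z) + \<gamma> * (\<rho> * d (fst z) (snd z) + \<beta>)" by simp
  qed
  have k\<pi>: "integrable \<pi> (\<lambda>z. k (snd z))" "(\<integral>z. k (snd z) \<partial>\<pi>) = (\<integral>y. k y \<partial>Q)"
    using integrable_distr[OF snd_m, of k] integral_distr[OF snd_m, of k] k_int snd_d by auto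
  have G\<pi>: "integrable \<pi> (\<lambda>z. Gr (fst z))" "(\<integral>z. Gr (fst z) \<partial>\<pi>) = V"
    using integrable_distr[OF fst_m, of Gr] integral_distr[OF fst_m, of Gr] gr(1) fst_d V_eq by auto
  have "(\<integral>y. k y \<partial>Q) \<le> (\<integral>z. Gr (fst z) + \<gamma> * (\<rho> * d (fst z) (snd z) + \<beta>) \<partial>\<pi>)"
    unfolding k\<pi>(2)[symmetric] using k\<pi>(1) G\<pi>(1) d_int AE_le by (intro integral_mono_AE) auto
  also have "\<dots> = V + \<gamma> * (\<rho> * (\<integral>z. d (fst z) (snd z) \<partial>\<pi>) + \<beta>)"
    using G\<pi> d_int \<pi>.prob_space by simp
  also have "\<dots> \<le> V + \<gamma> * (\<rho> * \<epsilon> + \<beta>)"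
    using d_le \<gamma> \<rho> by (intro add_left_mono mult_left_mono add_right_mono)
  finally have k_le: "(\<integral>y. k y \<partial>Q) \<le> V + \<gamma> * (\<rho> * \<epsilon> + \<beta>)" .
  have k_eq: "(\<integral>y. k y \<partial>Q) = (\<integral>y. l x y * h y \<partial>Q) - \<eta> * (1 - \<sigma>) - lam * E"
    unfolding k_def E_eq using lh_int h_int fh(1) h_mass by (simp add: left_diff_distrib)
  have ZP: "Z \<in> sets P" using Z setsP setsQ by simp
  have "(\<integral>y. l x y * indicator Z y \<partial>P) \<le> (\<integral>y. L * indicator Z y \<partial>P)"
    using l_int ZP l_range
    by (intro integral_mono integrable_real_mult_indicator) (auto simp: spP L_def indicator_def)
  also have "\<dots> = L * \<sigma>" using ZP by (simp add: \<sigma>_def)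
  finally have "(\<integral>y. l x y \<partial>P) \<le> (\<integral>y. l x y * h y \<partial>Q) + L * \<sigma>"
    using dec(2)[OF l_int] by simp
  also have "\<dots> = (\<integral>y. k y \<partial>Q) + \<eta> + (L - \<eta>) * \<sigma> + lam * E"
    using k_eq by (simp add: algebra_simps)
  also have "\<dots> \<le> V + \<gamma> * (\<rho> * \<epsilon> + \<beta>) + \<eta> + lam * (E + W)"
    using k_le sing by (simp add: algebra_simps)
  also have "\<dots> \<le> V + \<gamma> * (\<rho> * \<epsilon> + \<beta>) + \<eta> + lam * r"
    using EW lam by (intro add_left_mono mult_left_mono)
  finally show ?thesis by simp
qed

text \<open>The infima over \<open>Q\<close> and over couplings need not be attained, so both
  budgets are relaxed by \<open>e'\<close>. The bound grows by
  \<open>(lam + \<gamma> * \<rho>) * e'\<close>, which dictates the choice of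
  \<open>e'\<close>.\<close>

lemma dual_bound:
  fixes G :: "'a \<Rightarrow> ereal"
  assumes P: "P \<in> borel_probs S" and div: "smoothed_divergence S f d \<epsilon> Phat P \<le> ereal r"
    and \<epsilon>: "0 \<le> \<epsilon>" and lam: "0 \<le> lam" and \<gamma>: "0 \<le> \<gamma>" and \<rho>: "0 \<le> \<rho>"
    and feas: "f_infinity f = \<infinity> \<or> ereal (loss_sup S l x - \<eta>) \<le> f_infinity f * ereal lam"
    and G: "G \<in> borel_measurable Phat" "\<And>y. y \<in> S \<Longrightarrow> ereal g0 \<le> G y" "eintegral Phat G = ereal V"
    and le: "\<And>y z. y \<in> S \<Longrightarrow> z \<in> S \<Longrightarrow>
      scaled_conj f lam (l x z - \<eta>) \<le> G y + ereal (\<gamma> * (\<rho> * d y z + \<beta>))"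
  shows "(\<integral>y. l x y \<partial>P) \<le> V + lam * r + \<eta> + \<gamma> * (\<rho> * \<epsilon> + \<beta>)"
proof (rule field_le_epsilon)
  fix e :: real assume e: "0 < e"
  define e' where "e' = e / (lam + \<gamma> * \<rho> + 1)"
  have den: "0 < lam + \<gamma> * \<rho> + 1" using lam \<gamma> \<rho> by (simp add: add_nonneg_pos)
  have e': "0 < e'" "(lam + \<gamma> * \<rho>) * e' \<le> e"
    using e den by (auto simp: e'_def field_simps)
  have "smoothed_divergence S f d \<epsilon> Phat P < ereal (r + e')"
    using div e'(1) by (auto intro: order.strict_trans1)
  then obtain Q where Q: "Q \<in> borel_probs S" "transport_dist d Phat Q \<le> ennreal \<epsilon>"
    and D: "f_divergence f Q P < ereal (r + e')"
    unfolding smoothed_divergence_def INF_less_iff by blast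
  have "transport_dist d Phat Q < ennreal (\<epsilon> + e')"
    using Q(2) e' \<epsilon> by (auto intro!: order.strict_trans1[OF Q(2)] ennreal_lessI)
  then obtain \<pi> where \<pi>: "\<pi> \<in> couplings Phat Q"
    and cost: "(\<integral>\<^sup>+z. ennreal (d (fst z) (snd z)) \<partial>\<pi>) < ennreal (\<epsilon> + e')"
    unfolding transport_dist_def INF_less_iff by blast
  have "(\<integral>y. l x y \<partial>P) \<le> V + lam * (r + e') + \<eta> + \<gamma> * (\<rho> * (\<epsilon> + e') + \<beta>)"
    by (rule dual_bound_of_coupling[OF P Q(1) \<pi> less_imp_le[OF cost] _ less_imp_le[OF D]
        lam \<gamma> \<rho> feas G le]) (use \<epsilon> e' in auto)
  also have "\<dots> = V + lam * r + \<eta> + \<gamma> * (\<rho> * \<epsilon> + \<beta>) + (lam + \<gamma> * \<rho>) * e'"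
    by (simp add: algebra_simps)
  finally show "(\<integral>y. l x y \<partial>P) \<le> V + lam * r + \<eta> + \<gamma> * (\<rho> * \<epsilon> + \<beta>) + e"
    using e'(2) by simp
qed

end

section \<open>Duality for an arbitrary finite grid of radii containing 0\<close>

locale grid_setting = transport_setting S f d l x Phat
  for S :: "'a::euclidean_space set" and f :: "real \<Rightarrow> ereal" and d :: "'a \<Rightarrow> 'a \<Rightarrow> real"
    and l :: "'x \<Rightarrow> 'a \<Rightarrow> real" and x :: 'x and Phat :: "'a measure" +
  fixes \<Delta> :: "real set"
  assumes \<Delta>_finite: "finite \<Delta>" and \<Delta>_zero: "0 \<in> \<Delta>" and \<Delta>_nonneg: "\<And>\<delta>. \<delta> \<in> \<Delta> \<Longrightarrow> 0 \<le> \<delta>"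
begin

text \<open>Enumeration of all pairs of a grid point and a positive rational likelihood ratio;
  rational ratios suffice because the conjugate is a supremum over them.\<close>

definition radius :: "nat \<Rightarrow> real" where
  "radius n = fst (from_nat_into (\<Delta> \<times> {t \<in> \<rat>. 0 < (t::real)}) n)"

definition ratio :: "nat \<Rightarrow> real" where
  "ratio n = snd (from_nat_into (\<Delta> \<times> {t \<in> \<rat>. 0 < (t::real)}) n)"

definition div_cost :: "nat \<Rightarrow> real" where
  "div_cost n = real_of_ereal (f (ratio n))"

definition gain :: "nat \<Rightarrow> 'a \<Rightarrow> real" where
  "gain n y = loss_inflated S d l (radius n) x y"

definition dual_integrand :: "real \<Rightarrow> real \<Rightarrow> real \<Rightarrow> 'a \<Rightarrow> ereal" where
  "dual_integrand \<eta> lam \<gamma> y =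
     (SUP \<delta>\<in>\<Delta>. scaled_conj f lam (loss_inflated S d l \<delta> x y - \<eta>) - ereal (\<delta> * \<gamma>))"

text \<open>The Lagrangian contribution of a point that uses option \<open>n\<close>: reweighted
  gain net of the mass, divergence and transport prices.\<close>

definition dual_value :: "real \<Rightarrow> real \<Rightarrow> real \<Rightarrow> nat \<Rightarrow> 'a \<Rightarrow> real" where
  "dual_value \<eta> lam \<gamma> n y = (gain n y - \<eta>) * ratio n - lam * div_cost n - radius n * \<gamma>"

lemma radius_ratio: "radius n \<in> \<Delta>" "0 < ratio n"
proof -
  have "from_nat_into (\<Delta> \<times> {t \<in> \<rat>. 0 < (t::real)}) n \<in> \<Delta> \<times> {t \<in> \<rat>. 0 < (t::real)}"
    using \<Delta>_zero by (intro from_nat_into) (auto intro!: exI[of _ 1])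
  then show "radius n \<in> \<Delta>" "0 < ratio n" by (auto simp: radius_def ratio_def)
qed

lemma enumerated:
  assumes "\<delta> \<in> \<Delta>" "t \<in> \<rat>" "0 < t"
  obtains n where "radius n = \<delta>" "ratio n = t"
proof -
  have "countable (\<Delta> \<times> {t \<in> \<rat>. 0 < (t::real)})"
    using \<Delta>_finite countable_subset[OF _ countable_rat, of "{t \<in> \<rat>. 0 < (t::real)}"]
    by (intro countable_SIGMA) (auto intro: countable_finite)
  from from_nat_into_surj[OF this, of "(\<delta>, t)"] assms
  obtain n where "from_nat_into (\<Delta> \<times> {t \<in> \<rat>. 0 < (t::real)}) n = (\<delta>, t)" by auto
  then show thesis by (intro that[of n]) (simp_all add: radius_def ratio_def)
qed

lemma radius_nonneg: "0 \<le> radius n"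
  using radius_ratio \<Delta>_nonneg by blast

lemma div_cost: "f (ratio n) = ereal (div_cost n)"
  unfolding div_cost_def using generator_finite[OF f radius_ratio(2)] .

lemma transport_map_exists:
  "\<exists>T\<in>measurable BS BS. \<forall>y\<in>S. d y (T y) \<le> radius n \<and> l x (T y) = gain n y"
  unfolding gain_def by (rule loss_inflated_selection[OF radius_nonneg])

lemma gain_range:
  assumes "y \<in> S" shows "0 \<le> gain n y" "gain n y \<le> loss_sup S l x"
proof -
  obtain T where "T \<in> measurable BS BS" "\<forall>y\<in>S. l x (T y) = gain n y"
    using transport_map_exists[of n] by blast
  moreover from this have "T y \<in> S"
    using assms measurable_space[of T BS BS y] by (simp add: space_restrict_space)
  ultimately show "0 \<le> gain n y" "gain n y \<le> loss_sup S l x"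
    using l_range assms by force+
qed

lemma gain_measurable: "gain n \<in> borel_measurable Phat"
proof -
  obtain T where T: "T \<in> measurable BS BS" "\<forall>y\<in>S. l x (T y) = gain n y"
    using transport_map_exists[of n] by blast
  have "(\<lambda>y. l x (T y)) \<in> borel_measurable BS" using T(1) by measurable
  then have "gain n \<in> borel_measurable BS"
    using T(2) by (subst (asm) measurable_cong) (auto simp: space_restrict_space)
  then show ?thesis using measurable_cong_sets[OF sets_Phat refl] by blast
qed

lemma gain_integrable: "integrable Phat (gain n)"
  using gain_range gain_measurable
  by (intro Phat.integrable_const_bound[of _ "loss_sup S l x"] AE_I2) (auto simp: space_Phat)

lemma dual_value_integrable: "integrable Phat (dual_value \<eta> lam \<gamma> n)"
  unfolding dual_value_def[abs_def] using gain_integrable by simp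

text \<open>Countability of this supremum gives measurability of the integrand and allows the
  supremum to be taken out of the integral through finite maxima.\<close>

lemma dual_integrand_eq_SUP:
  assumes lam: "0 \<le> lam"
  shows "dual_integrand \<eta> lam \<gamma> y = (SUP n. ereal (dual_value \<eta> lam \<gamma> n y))"
proof (rule antisym)
  show "dual_integrand \<eta> lam \<gamma> y \<le> (SUP n. ereal (dual_value \<eta> lam \<gamma> n y))"
    unfolding dual_integrand_def
  proof (rule SUP_least)
    fix \<delta> assume \<delta>: "\<delta> \<in> \<Delta>"
    have "scaled_conj f lam (loss_inflated S d l \<delta> x y - \<eta>)
        \<le> (SUP n. ereal (dual_value \<eta> lam \<gamma> n y)) + ereal (\<delta> * \<gamma>)"
      unfolding scaled_conj_eq_SUP_Rats[OF f lam]
    proof (rule SUP_least)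
      fix t :: real assume "t \<in> {t \<in> \<rat>. 0 < (t::real)}"
      then obtain n where n: "radius n = \<delta>" "ratio n = t"
        using enumerated[OF \<delta>, of t] by blast
      have "ereal ((loss_inflated S d l \<delta> x y - \<eta>) * t - lam * real_of_ereal (f t))
          = ereal (dual_value \<eta> lam \<gamma> n y) + ereal (\<delta> * \<gamma>)"
        using n by (simp add: dual_value_def gain_def div_cost_def)
      also have "\<dots> \<le> (SUP n. ereal (dual_value \<eta> lam \<gamma> n y)) + ereal (\<delta> * \<gamma>)"
        by (intro add_right_mono SUP_upper) auto
      finally show "ereal ((loss_inflated S d l \<delta> x y - \<eta>) * t - lam * real_of_ereal (f t))
          \<le> (SUP n. ereal (dual_value \<eta> lam \<gamma> n y)) + ereal (\<delta> * \<gamma>)" .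
    qed
    then show "scaled_conj f lam (loss_inflated S d l \<delta> x y - \<eta>) - ereal (\<delta> * \<gamma>)
        \<le> (SUP n. ereal (dual_value \<eta> lam \<gamma> n y))"
      by (simp add: ereal_minus_le)
  qed
  show "(SUP n. ereal (dual_value \<eta> lam \<gamma> n y)) \<le> dual_integrand \<eta> lam \<gamma> y"
  proof (rule SUP_least)
    fix n
    have "ereal (dual_value \<eta> lam \<gamma> n y)
        = (ereal ((gain n y - \<eta>) * ratio n) - ereal lam * f (ratio n)) - ereal (radius n * \<gamma>)"
      by (simp add: dual_value_def div_cost)
    also have "\<dots> \<le> scaled_conj f lam (gain n y - \<eta>) - ereal (radius n * \<gamma>)"
      unfolding scaled_conj_def using radius_ratio(2)[of n]
      by (intro ereal_minus_mono SUP_upper order_refl) auto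
    also have "\<dots> \<le> dual_integrand \<eta> lam \<gamma> y"
      unfolding dual_integrand_def gain_def using radius_ratio(1)[of n] by (intro SUP_upper) auto
    finally show "ereal (dual_value \<eta> lam \<gamma> n y) \<le> dual_integrand \<eta> lam \<gamma> y" .
  qed
qed

lemma dual_integrand_measurable:
  assumes "0 \<le> lam" shows "dual_integrand \<eta> lam \<gamma> \<in> borel_measurable Phat"
  unfolding dual_integrand_eq_SUP[OF assms, abs_def]
  using borel_measurable_integrable[OF dual_value_integrable] by measurable

text \<open>Staying put with ratio 1 costs nothing, since \<open>f 1 = 0\<close>, and gains a
  nonnegative loss. The bound serves as integrable minorant and as the source of nonnegativity of
  the dual objective.\<close>

lemma dual_integrand_ge:
  assumes "0 \<le> lam" "y \<in> S" shows "ereal (- \<eta>) \<le> dual_integrand \<eta> lam \<gamma> y"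
proof -
  obtain n where n: "radius n = 0" "ratio n = 1"
    using enumerated[OF \<Delta>_zero, of 1] by auto
  have "div_cost n = 0" using f n by (simp add: div_cost_def divergence_generator_def)
  then have "ereal (- \<eta>) \<le> ereal (dual_value \<eta> lam \<gamma> n y)"
    using n gain_range(1)[OF assms(2), of n] by (simp add: dual_value_def)
  also have "\<dots> \<le> dual_integrand \<eta> lam \<gamma> y"
    unfolding dual_integrand_eq_SUP[OF assms(1)] by (intro SUP_upper) auto
  finally show ?thesis .
qed

lemma scaled_conj_mono:
  assumes "a \<le> b" shows "scaled_conj f lam a \<le> scaled_conj f lam b"
  unfolding scaled_conj_def
  using assms by (intro SUP_mono) (auto intro!: bexI ereal_minus_mono mult_right_mono)

text \<open>Rounding a transport distance up to the grid costs a factor \<open>\<rho>\<close> and an additive \<open>\<beta>\<close>;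
  the loss is absorbed because \<open>V + \<eta>\<close> below is nonnegative.\<close>

lemma predictor_le_dual:
  assumes round: "\<And>y z. y \<in> S \<Longrightarrow> z \<in> S \<Longrightarrow> \<exists>\<delta>\<in>\<Delta>. d y z \<le> \<delta> \<and> \<delta> \<le> \<rho> * d y z + \<beta>"
    and \<epsilon>: "0 < \<epsilon>" and r: "0 \<le> r" and \<rho>: "1 \<le> \<rho>" and \<beta>: "0 \<le> \<beta>"
    and lam: "0 \<le> lam" and \<gamma>: "0 \<le> \<gamma>"
    and feas: "f_infinity f = \<infinity> \<or> ereal (loss_sup S l x - \<eta>) \<le> f_infinity f * ereal lam"
  shows "predictor S f d l r \<epsilon> x Phat
    \<le> ereal (\<rho> + \<beta> / \<epsilon>) * (eintegral Phat (dual_integrand \<eta> lam \<gamma>) + ereal (r * lam + \<eta> + \<epsilon> * \<gamma>))"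
proof -
  define C where "C = \<rho> + \<beta> / \<epsilon>"
  have C: "1 \<le> C" using \<rho> \<beta> \<epsilon> by (simp add: C_def add_increasing2)
  note meas = dual_integrand_measurable[OF lam, of \<eta> \<gamma>]
  have "ereal (\<integral>y. - \<eta> \<partial>Phat) \<le> eintegral Phat (dual_integrand \<eta> lam \<gamma>)"
    using dual_integrand_ge[OF lam] by (intro eintegral_ge meas) (auto simp: space_Phat)
  then have ge: "ereal (- \<eta>) \<le> eintegral Phat (dual_integrand \<eta> lam \<gamma>)"
    by (simp add: Phat.prob_space)
  show ?thesis
  proof (cases "eintegral Phat (dual_integrand \<eta> lam \<gamma>)")
    case PInf
    then show ?thesis using C by (simp add: C_def[symmetric])
  next
    case MInf
    then show ?thesis using ge by simp
  next
    case (real V)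
    have le: "scaled_conj f lam (l x z - \<eta>)
        \<le> dual_integrand \<eta> lam \<gamma> y + ereal (\<gamma> * (\<rho> * d y z + \<beta>))" if yz: "y \<in> S" "z \<in> S" for y z
    proof -
      obtain \<delta> where \<delta>: "\<delta> \<in> \<Delta>" "d y z \<le> \<delta>" "\<delta> \<le> \<rho> * d y z + \<beta>" using round[OF yz] by blast
      have "scaled_conj f lam (l x z - \<eta>) \<le> scaled_conj f lam (loss_inflated S d l \<delta> x y - \<eta>)"
        using loss_inflated_ge[OF yz \<delta>(2)] by (intro scaled_conj_mono) simp
      also have "\<dots> \<le> dual_integrand \<eta> lam \<gamma> y + ereal (\<delta> * \<gamma>)"
      proof -
        have "scaled_conj f lam (loss_inflated S d l \<delta> x y - \<eta>) - ereal (\<delta> * \<gamma>) \<le> dual_integrand \<eta> lam \<gamma> y"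
          unfolding dual_integrand_def using \<delta>(1) by (intro SUP_upper)
        then show ?thesis by (simp add: ereal_minus_le)
      qed
      also have "\<dots> \<le> dual_integrand \<eta> lam \<gamma> y + ereal (\<gamma> * (\<rho> * d y z + \<beta>))"
        using mult_right_mono[OF \<delta>(3) \<gamma>] by (intro add_left_mono) (simp add: mult.commute)
      finally show ?thesis .
    qed
    have bound: "(\<integral>y. l x y \<partial>P) \<le> C * (V + (r * lam + \<eta> + \<epsilon> * \<gamma>))"
      if P: "P \<in> borel_probs S" "smoothed_divergence S f d \<epsilon> Phat P \<le> ereal r" for P
    proof -
      have "(\<integral>y. l x y \<partial>P) \<le> V + lam * r + \<eta> + \<gamma> * (\<rho> * \<epsilon> + \<beta>)"
        using \<epsilon> \<rho> by (intro dual_bound[OF P _ lam \<gamma> _ feas meas dual_integrand_ge[OF lam] real le]) auto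
      also have "\<gamma> * (\<rho> * \<epsilon> + \<beta>) = C * (\<epsilon> * \<gamma>)" using \<epsilon> by (simp add: C_def field_simps)
      also have "V + lam * r + \<eta> \<le> C * (V + lam * r + \<eta>)"
      proof -
        have "0 \<le> V + \<eta>" "0 \<le> lam * r" using ge real lam r by simp_all
        then have "0 \<le> V + lam * r + \<eta>" by linarith
        then show ?thesis using C mult_right_mono[of 1 C "V + lam * r + \<eta>"] by simp
      qed
      finally show ?thesis by (simp add: algebra_simps)
    qed
    then have "predictor S f d l r \<epsilon> x Phat \<le> ereal (C * (V + (r * lam + \<eta> + \<epsilon> * \<gamma>)))"
      unfolding predictor_def by (intro SUP_least) auto
    then show ?thesis using real by (simp add: C_def)
  qed
qed


section \<open>Strong duality\<close>

text \<open>A real stand-in for the recession slope. The default 0 in the infinite case is harmless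
  because singular mass is then required to vanish.\<close>

definition recession :: real where
  "recession = (if f_infinity f = \<infinity> then 0 else real_of_ereal (f_infinity f))"

text \<open>The sample space carries an index: \<open>j \<ge> 1\<close> selects a strategy of the mixture, and \<open>j = 0\<close>,
  which has no mass under the transported measure, carries the singular mass \<open>\<sigma>\<close> placed at a
  maximiser of the loss.\<close>

lemma mixture_le_predictor:
  fixes k :: nat and u s :: "nat \<Rightarrow> real" and i :: "nat \<Rightarrow> 'a \<Rightarrow> nat" and n :: "nat \<Rightarrow> nat"
  assumes u: "\<And>j. j \<in> {1..k} \<Longrightarrow> 0 \<le> u j" "(\<Sum>j=1..k. u j) = 1"
    and s: "\<And>j. j \<in> {1..k} \<Longrightarrow> 0 \<le> s j" "\<And>j. j \<in> {1..k} \<Longrightarrow> f_infinity f = \<infinity> \<Longrightarrow> s j = 0"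
    and i: "\<And>j. j \<in> {1..k} \<Longrightarrow> i j \<in> measurable Phat (count_space UNIV)"
      "\<And>j y. j \<in> {1..k} \<Longrightarrow> y \<in> S \<Longrightarrow> i j y \<le> n j"
    and mass: "(\<Sum>j=1..k. u j * ((\<integral>y. ratio (i j y) \<partial>Phat) + s j)) = 1"
    and div: "(\<Sum>j=1..k. u j * ((\<integral>y. div_cost (i j y) \<partial>Phat) + recession * s j)) \<le> r"
    and cost: "(\<Sum>j=1..k. u j * (\<integral>y. radius (i j y) \<partial>Phat)) \<le> \<epsilon>"
  shows "ereal (\<Sum>j=1..k. u j * ((\<integral>y. ratio (i j y) * gain (i j y) y \<partial>Phat) + s j * loss_sup S l x))
    \<le> predictor S f d l r \<epsilon> x Phat"
proof -
  define J where "J = insert 0 {1..k}"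
  define B where "B = count_space J \<Otimes>\<^sub>M Phat"
  define \<sigma> where "\<sigma> = (\<Sum>j=1..k. u j * s j)"
  have \<sigma>: "0 \<le> \<sigma>" "f_infinity f = \<infinity> \<Longrightarrow> \<sigma> = 0"
    using u(1) s by (auto simp: \<sigma>_def intro!: sum_nonneg)
  have spB: "space B = J \<times> S" by (simp add: B_def space_pair_measure space_Phat)
  have finJ: "finite J" by (simp add: J_def)
  have idx: "integrable Phat (\<lambda>y. c (i j y) y)"
    if "j \<in> {1..k}" "\<And>m. integrable Phat (c m)" for c :: "nat \<Rightarrow> 'a \<Rightarrow> real" and j
    by (rule integrable_compose_index[OF that(2) i(1)[OF that(1)], of "n j"])
      (use i(2)[OF that(1)] space_Phat in simp)
  have idx': "integrable Phat (\<lambda>y. c (i j y))" if "j \<in> {1..k}" for c :: "nat \<Rightarrow> real" and j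
    using idx[OF that, of "\<lambda>m _. c m"] by simp
  have B_int: "integrable B (\<lambda>w. g (fst w) (snd w))"
    and B_eq: "(\<integral>w. g (fst w) (snd w) \<partial>B) = (\<integral>y. g 0 y \<partial>Phat) + (\<Sum>j=1..k. \<integral>y. g j y \<partial>Phat)"
    if "integrable Phat (g 0)" "\<And>j. j \<in> {1..k} \<Longrightarrow> integrable Phat (g j)" for g :: "nat \<Rightarrow> 'a \<Rightarrow> real"
  proof -
    have "integrable Phat (g j)" if "j \<in> J" for j
      using that \<open>integrable Phat (g 0)\<close> \<open>\<And>j. j \<in> {1..k} \<Longrightarrow> integrable Phat (g j)\<close>
      by (auto simp: J_def)
    note * = integral_count_space_pair[OF finJ Phat.finite_measure_axioms this, folded B_def]
    show "integrable B (\<lambda>w. g (fst w) (snd w))" by (rule *(1))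
    show "(\<integral>w. g (fst w) (snd w) \<partial>B) = (\<integral>y. g 0 y \<partial>Phat) + (\<Sum>j=1..k. \<integral>y. g j y \<partial>Phat)"
      using *(2) by (simp add: J_def)
  qed
  have B_sum: "(\<integral>w. g (fst w) (snd w) \<partial>B) = c0 + (\<Sum>j=1..k. c j)"
    if "integrable Phat (g 0)" "\<And>j. j \<in> {1..k} \<Longrightarrow> integrable Phat (g j)"
      "(\<integral>y. g 0 y \<partial>Phat) = c0" "\<And>j. j \<in> {1..k} \<Longrightarrow> (\<integral>y. g j y \<partial>Phat) = c j"
    for g :: "nat \<Rightarrow> 'a \<Rightarrow> real" and c0 and c :: "nat \<Rightarrow> real"
    using B_eq[of g, OF that(1,2)] that(3,4) by simp
  obtain Tm where Tm: "\<And>m. Tm m \<in> measurable BS BS" "\<And>m y. y \<in> S \<Longrightarrow> d y (Tm m y) \<le> radius m"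
    "\<And>m y. y \<in> S \<Longrightarrow> l x (Tm m y) = gain m y"
    using transport_map_exists by metis
  obtain y0 where y0: "y0 \<in> S" "l x y0 = loss_sup S l x" using loss_sup_attained by blast
  \<comment> \<open>Copy \<open>j\<close> has density \<open>u j\<close> under \<open>q\<close>, and
    \<open>u j\<close> times the likelihood ratio under \<open>p\<close>. Copy 0 has no
    \<open>q\<close>-mass. After mapping by \<open>T\<close>, \<open>Q\<close> may still charge
    \<open>y0\<close>; the data-processing bound tolerates this, since it works on the sample
    space.\<close>
  define q where "q j y = (if j = 0 then 0 else u j)" for j and y :: 'a
  define p where "p j y = (if j = 0 then \<sigma> else u j * ratio (i j y))" for j y
  define T where "T w = (if fst w = 0 then y0 else Tm (i (fst w) (snd w)) (snd w))" for w
  let ?q = "\<lambda>w. q (fst w) (snd w)" and ?p = "\<lambda>w. p (fst w) (snd w)"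
  have p0: "0 \<le> ?p w" and q0: "0 \<le> ?q w" if "w \<in> space B" for w
    using that u(1) \<sigma>(1) less_imp_le[OF radius_ratio(2)] by (auto simp: p_def q_def spB J_def)
  have p_int: "integrable B ?p" and p_eq: "(\<integral>w. ?p w \<partial>B) = 1"
  proof -
    have *: "integrable Phat (p 0)" "\<And>j. j \<in> {1..k} \<Longrightarrow> integrable Phat (p j)"
      using idx' by (auto simp: p_def[abs_def])
    show "integrable B ?p" by (rule B_int[of p, OF *])
    have "(\<integral>w. ?p w \<partial>B) = \<sigma> + (\<Sum>j=1..k. u j * (\<integral>y. ratio (i j y) \<partial>Phat))"
      by (rule B_sum[of p, OF *]) (auto simp: p_def Phat.prob_space)
    then show "(\<integral>w. ?p w \<partial>B) = 1"
      using mass by (simp add: \<sigma>_def distrib_left sum.distrib)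
  qed
  have q_int: "integrable B ?q" and q_eq: "(\<integral>w. ?q w \<partial>B) = 1"
  proof -
    have *: "integrable Phat (q 0)" "\<And>j. j \<in> {1..k} \<Longrightarrow> integrable Phat (q j)"
      by (auto simp: q_def[abs_def])
    show "integrable B ?q" by (rule B_int[of q, OF *])
    have "(\<integral>w. ?q w \<partial>B) = 0 + (\<Sum>j=1..k. u j)"
      by (rule B_sum[of q, OF *]) (auto simp: q_def Phat.prob_space)
    then show "(\<integral>w. ?q w \<partial>B) = 1" using u(2) by simp
  qed
  have T_m: "T \<in> measurable B BS"
    unfolding B_def
  proof (rule measurable_pair_measure_countable1)
    fix j assume j: "j \<in> J"
    show "(\<lambda>y. T (j, y)) \<in> measurable Phat BS"
    proof (cases "j = 0")
      case True
      then show ?thesis using y0(1) by (simp add: T_def space_restrict_space)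
    next
      case False
      then have j': "j \<in> {1..k}" using j by (auto simp: J_def)
      have Tm': "Tm m \<in> measurable Phat BS" for m
        using Tm(1) measurable_cong_sets[OF sets_Phat refl] by blast
      have "(\<lambda>y. Tm (i j y) y) \<in> measurable Phat BS"
        by (rule measurable_compose_countable[OF Tm' i(1)[OF j']])
      then show ?thesis using False by (simp add: T_def)
    qed
  qed (simp add: J_def)
  have prob: "prob_space (density B (\<lambda>w. ennreal (g w)))"
    if g: "integrable B g" "\<And>w. w \<in> space B \<Longrightarrow> 0 \<le> g w" "(\<integral>w. g w \<partial>B) = 1" for g
  proof (rule prob_spaceI)
    have "emeasure (density B (\<lambda>w. ennreal (g w))) (space B) = (\<integral>\<^sup>+w. ennreal (g w) \<partial>B)"
      using g by (subst emeasure_density) (auto intro!: nn_integral_cong)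
    also have "\<dots> = 1" using g by (subst nn_integral_eq_integral) auto
    finally show "emeasure (density B (\<lambda>w. ennreal (g w))) (space (density B (\<lambda>w. ennreal (g w)))) = 1"
      by simp
  qed
  define P where "P = distr (density B (\<lambda>w. ennreal (?p w))) BS T"
  define Q where "Q = distr (density B (\<lambda>w. ennreal (?q w))) BS T"
  interpret p: prob_space "density B (\<lambda>w. ennreal (?p w))" by (rule prob[OF p_int p0 p_eq])
  interpret q: prob_space "density B (\<lambda>w. ennreal (?q w))" by (rule prob[OF q_int q0 q_eq])
  have P: "P \<in> borel_probs S" and Q: "Q \<in> borel_probs S"
    unfolding borel_probs_def P_def Q_def using T_m
    by (auto intro: p.prob_space_distr q.prob_space_distr)
  have prP: "prob_space P" and prQ: "prob_space Q" using P Q by (auto simp: borel_probs_def)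
  have T_S: "T w \<in> S" if "w \<in> space B" for w
    using measurable_space[OF T_m that] by (simp add: space_restrict_space)
  have lT: "l x (T w) = (if fst w = 0 then loss_sup S l x else gain (i (fst w) (snd w)) (snd w))"
    if "w \<in> space B" for w
    using that Tm(3) y0(2) by (auto simp: T_def spB)

  have D: "f_divergence f Q P \<le> ereal r"
  proof -
    obtain a b :: "nat \<Rightarrow> real" where ab: "\<forall>u\<ge>0. f u = (SUP n. ereal (a n * u + b n))"
      and finf: "f_infinity f = (SUP n. ereal (a n))"
      using generator_minorants[OF f] by blast
    \<comment> \<open>The perspective of \<open>f\<close> at the two densities: where
      \<open>q\<close> vanishes it is the recession slope times \<open>\<sigma>\<close>, elsewhere
      the weight times \<open>f\<close> of the ratio.\<close>
    define F where "F j y = (if j = 0 then recession * \<sigma> else u j * div_cost (i j y))" for j y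
    have *: "integrable Phat (F 0)" "\<And>j. j \<in> {1..k} \<Longrightarrow> integrable Phat (F j)"
      using idx' by (auto simp: F_def[abs_def])
    have le: "a m * ?p w + b m * ?q w \<le> F (fst w) (snd w)" if w: "w \<in> space B" for m w
    proof (cases "fst w = 0")
      case True
      have "ereal (a m) \<le> f_infinity f" unfolding finf by (intro SUP_upper) auto
      then have "f_infinity f \<noteq> \<infinity> \<Longrightarrow> a m \<le> recession"
        by (cases "f_infinity f") (auto simp: recession_def)
      then have "a m * \<sigma> \<le> recession * \<sigma>"
        using \<sigma> by (cases "f_infinity f = \<infinity>") (auto intro: mult_right_mono)
      then show ?thesis using True by (simp add: p_def q_def F_def)
    next
      case False
      let ?m = "i (fst w) (snd w)"
      have "ereal (a m * ratio ?m + b m) \<le> f (ratio ?m)"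
        using ab radius_ratio(2)[of ?m] by (auto intro!: SUP_upper)
      then have "a m * ratio ?m + b m \<le> div_cost ?m" by (simp add: div_cost)
      from mult_left_mono[OF this, of "u (fst w)"] show ?thesis
        using False w u(1) by (auto simp: p_def q_def F_def spB J_def algebra_simps)
    qed
    have "f_divergence f Q P \<le> ereal (\<integral>w. F (fst w) (snd w) \<partial>B)"
      by (rule f_divergence_le[OF ab[rule_format] finf T_m p_int p0 q_int q0 P_def prP Q_def prQ B_int[of F, OF *] le])
    also have "(\<integral>w. F (fst w) (snd w) \<partial>B) = recession * \<sigma> + (\<Sum>j=1..k. u j * (\<integral>y. div_cost (i j y) \<partial>Phat))"
      by (rule B_sum[of F, OF *]) (auto simp: F_def Phat.prob_space)
    also have "\<dots> = (\<Sum>j=1..k. u j * ((\<integral>y. div_cost (i j y) \<partial>Phat) + recession * s j))"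
      by (simp add: \<sigma>_def distrib_left sum.distrib sum_distrib_left mult_ac)
    also have "\<dots> \<le> r" by (rule div)
    finally show ?thesis by simp
  qed

  have W: "transport_dist d Phat Q \<le> ennreal \<epsilon>"
  proof -
    \<comment> \<open>Pairing start and end point gives the coupling. Copy 0 has no mass under it,
      so the jump to \<open>y0\<close> adds no transport cost.\<close>
    define R where "R w = (snd w, T w)" for w :: "nat \<times> 'a"
    define \<pi> where "\<pi> = distr (density B (\<lambda>w. ennreal (?q w))) (Phat \<Otimes>\<^sub>M Q) R"
    have setsQ: "sets Q = sets BS" by (simp add: Q_def)
    have snd_m: "snd \<in> measurable B Phat" unfolding B_def by (rule measurable_snd)
    have TQ: "T \<in> measurable B Q" using T_m measurable_cong_sets[OF refl setsQ] by blast
    have R_m: "R \<in> measurable B (Phat \<Otimes>\<^sub>M Q)"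
      unfolding R_def[abs_def] using snd_m TQ by (rule measurable_Pair)
    have "distr \<pi> Phat fst = distr (density B (\<lambda>w. ennreal (?q w))) Phat snd"
      unfolding \<pi>_def using R_m by (subst distr_distr) (auto simp: R_def comp_def)
    also have "\<dots> = Phat"
    proof (rule measure_eqI)
      fix A assume "A \<in> sets (distr (density B (\<lambda>w. ennreal (?q w))) Phat snd)"
      then have A: "A \<in> sets Phat" by simp
      define g where "g j y = q j y * indicator A y" for j y
      have *: "integrable Phat (g 0)" "\<And>j. j \<in> {1..k} \<Longrightarrow> integrable Phat (g j)"
        using A by (auto simp: g_def[abs_def] q_def less_top[symmetric] Phat.emeasure_finite
            intro!: integrable_real_indicator)
      have "emeasure (distr (density B (\<lambda>w. ennreal (?q w))) Phat snd) A
          = emeasure (density B (\<lambda>w. ennreal (?q w))) (snd -` A \<inter> space B)"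
        using A snd_m by (subst emeasure_distr) auto
      also have "\<dots> = (\<integral>\<^sup>+w. ennreal (g (fst w) (snd w)) \<partial>B)"
        using A snd_m q_int by (subst emeasure_density)
          (auto intro!: nn_integral_cong simp: g_def indicator_def)
      also have "\<dots> = ennreal (\<integral>w. g (fst w) (snd w) \<partial>B)"
        by (intro nn_integral_eq_integral B_int[of g, OF *] AE_I2)
          (auto simp: g_def intro!: mult_nonneg_nonneg q0)
      also have "(\<integral>w. g (fst w) (snd w) \<partial>B) = 0 + (\<Sum>j=1..k. u j * measure Phat A)"
        by (rule B_sum[of g, OF *]) (use A in \<open>auto simp: g_def q_def\<close>)
      also have "\<dots> = measure Phat A"
        using u(2) by (simp flip: sum_distrib_right)
      finally show "emeasure (distr (density B (\<lambda>w. ennreal (?q w))) Phat snd) A = emeasure Phat A"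
        by (simp add: Phat.emeasure_eq_measure)
    qed simp
    finally have marg1: "distr \<pi> Phat fst = Phat" .
    have "distr \<pi> Q snd = distr (density B (\<lambda>w. ennreal (?q w))) Q T"
      unfolding \<pi>_def using R_m by (subst distr_distr) (auto simp: R_def comp_def)
    also have "\<dots> = Q"
      unfolding Q_def by (intro distr_cong) auto
    finally have marg2: "distr \<pi> Q snd = Q" .
    have "\<pi> \<in> couplings Phat Q"
      unfolding couplings_def using marg1 marg2 R_m
      by (auto simp: \<pi>_def intro!: q.prob_space_distr)
    then have "transport_dist d Phat Q \<le> (\<integral>\<^sup>+z. ennreal (d (fst z) (snd z)) \<partial>\<pi>)"
      unfolding transport_dist_def by (rule INF_lower)
    also have d_m: "(\<lambda>z. d (fst z) (snd z)) \<in> borel_measurable (Phat \<Otimes>\<^sub>M Q)"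
      using d_measurable measurable_cong_sets[OF sets_pair_measure_cong[OF sets_Phat setsQ] refl] by blast
    then have "(\<integral>\<^sup>+z. ennreal (d (fst z) (snd z)) \<partial>\<pi>)
        = (\<integral>\<^sup>+w. ennreal (d (snd w) (T w)) \<partial>density B (\<lambda>w. ennreal (?q w)))"
      unfolding \<pi>_def using R_m by (subst nn_integral_distr) (auto simp: R_def)
    also have "\<dots> = (\<integral>\<^sup>+w. ennreal (?q w) * ennreal (d (snd w) (T w)) \<partial>B)"
      using measurable_compose[OF R_m d_m] q_int
      by (subst nn_integral_density) (auto simp: R_def)
    also have "\<dots> \<le> (\<integral>\<^sup>+w. ennreal (q (fst w) (snd w) * radius (i (fst w) (snd w))) \<partial>B)"
    proof (rule nn_integral_mono)
      fix w assume w: "w \<in> space B"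
      have "?q w * d (snd w) (T w) \<le> ?q w * radius (i (fst w) (snd w))"
      proof (cases "fst w = 0")
        case False
        then show ?thesis
          using w Tm(2)[of "snd w"] q0[OF w] by (intro mult_left_mono) (auto simp: T_def spB)
      next
        case True
        then show ?thesis by (simp add: q_def)
      qed
      then show "ennreal (?q w) * ennreal (d (snd w) (T w))
          \<le> ennreal (q (fst w) (snd w) * radius (i (fst w) (snd w)))"
        using d_nonneg[of "snd w" "T w"] T_S[OF w] w q0[OF w]
        by (subst ennreal_mult[symmetric]) (auto simp: spB intro!: ennreal_leI)
    qed
    also have "\<dots> = ennreal (\<Sum>j=1..k. u j * (\<integral>y. radius (i j y) \<partial>Phat))"
    proof -
      \<comment> \<open>Nothing is assumed about \<open>i 0\<close>; the factor
        \<open>q 0 y = 0\<close> removes the term.\<close>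
      have *: "integrable Phat (\<lambda>y. q 0 y * radius (i 0 y))"
        "\<And>j. j \<in> {1..k} \<Longrightarrow> integrable Phat (\<lambda>y. q j y * radius (i j y))"
        using idx' by (auto simp: q_def)
      have "(\<integral>\<^sup>+w. ennreal (q (fst w) (snd w) * radius (i (fst w) (snd w))) \<partial>B)
          = ennreal (\<integral>w. q (fst w) (snd w) * radius (i (fst w) (snd w)) \<partial>B)"
        using q0 radius_nonneg by (intro nn_integral_eq_integral B_int[of "\<lambda>j y. q j y * radius (i j y)", OF *] AE_I2
            mult_nonneg_nonneg) auto
      also have "(\<integral>w. q (fst w) (snd w) * radius (i (fst w) (snd w)) \<partial>B)
          = 0 + (\<Sum>j=1..k. u j * (\<integral>y. radius (i j y) \<partial>Phat))"
        by (rule B_sum[of "\<lambda>j y. q j y * radius (i j y)", OF *]) (auto simp: q_def)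
      finally show ?thesis by simp
    qed
    also have "\<dots> \<le> ennreal \<epsilon>" using cost by (rule ennreal_leI)
    finally show ?thesis .
  qed

  have L: "(\<integral>y. l x y \<partial>P) =
      (\<Sum>j=1..k. u j * ((\<integral>y. ratio (i j y) * gain (i j y) y \<partial>Phat) + s j * loss_sup S l x))"
  proof -
    define g where "g j y = (if j = 0 then \<sigma> * loss_sup S l x else u j * (ratio (i j y) * gain (i j y) y))" for j y
    have *: "integrable Phat (g 0)" "\<And>j. j \<in> {1..k} \<Longrightarrow> integrable Phat (g j)"
      using idx[of _ "\<lambda>m y. ratio m * gain m y"] gain_integrable by (auto simp: g_def[abs_def])
    have "(\<integral>y. l x y \<partial>P) = (\<integral>w. l x (T w) \<partial>density B (\<lambda>w. ennreal (?p w)))"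
      unfolding P_def using T_m by (subst integral_distr) auto
    also have "\<dots> = (\<integral>w. ?p w *\<^sub>R l x (T w) \<partial>B)"
      using measurable_compose[OF T_m l_measurable] p_int p0
      by (subst integral_density) auto
    also have "\<dots> = (\<integral>w. g (fst w) (snd w) \<partial>B)"
      by (intro Bochner_Integration.integral_cong) (auto simp: lT p_def g_def)
    also have "\<dots> = \<sigma> * loss_sup S l x + (\<Sum>j=1..k. u j * (\<integral>y. ratio (i j y) * gain (i j y) y \<partial>Phat))"
      by (rule B_sum[of g, OF *]) (auto simp: g_def Phat.prob_space)
    finally show ?thesis
      by (simp add: \<sigma>_def distrib_left sum.distrib sum_distrib_left mult_ac)
  qed

  have "smoothed_divergence S f d \<epsilon> Phat P \<le> ereal r"
    unfolding smoothed_divergence_def using W Q D by (intro INF_lower2[of Q]) auto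
  then show ?thesis
    unfolding L[symmetric] predictor_def using P by (intro SUP_upper) auto
qed


text \<open>The coordinates are the total mass, divergence, transport cost and expected loss
  achieved by the pure strategy \<open>i\<close> with extra singular mass \<open>s\<close> at a
  maximiser of the loss.\<close>

definition outcome :: "('a \<Rightarrow> nat) \<Rightarrow> real \<Rightarrow> real \<times> real \<times> real \<times> real" where
  "outcome i s =
     ((\<integral>y. ratio (i y) \<partial>Phat) + s, (\<integral>y. div_cost (i y) \<partial>Phat) + recession * s,
      (\<integral>y. radius (i y) \<partial>Phat), (\<integral>y. ratio (i y) * gain (i y) y \<partial>Phat) + s * loss_sup S l x)"

text \<open>Bounding the index restricts a strategy to finitely many options, which makes all four
  coordinates integrals of integrable functions. Mass, divergence and cost are left unconstrained,
  as they are to be dualised.\<close>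

definition outcomes :: "(real \<times> real \<times> real \<times> real) set" where
  "outcomes = {outcome i s | i s. i \<in> measurable Phat (count_space UNIV) \<and> (\<exists>n. \<forall>y\<in>S. i y \<le> n) \<and>
     0 \<le> s \<and> (f_infinity f = \<infinity> \<longrightarrow> s = 0)}"

text \<open>The outcomes themselves need not form a convex set; a point of the hull is realised as a
  mixture. The first coordinate 1 says that the reweighted mixture is again a probability.\<close>

lemma convex_hull_outcomes_le_predictor:
  assumes "(1, D, c, g) \<in> convex hull outcomes" "D \<le> r" "c \<le> \<epsilon>"
  shows "ereal g \<le> predictor S f d l r \<epsilon> x Phat"
proof -
  obtain k u z where u: "\<forall>j\<in>{1::nat..k}. 0 \<le> u j \<and> z j \<in> outcomes" "(\<Sum>j=1..k. u j) = 1"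
    and z: "(\<Sum>j=1..k. u j *\<^sub>R z j) = (1, D, c, g)"
    using assms(1) unfolding convex_hull_indexed by auto
  have "\<forall>j\<in>{1..k}. \<exists>i s n. z j = outcome i s \<and> i \<in> measurable Phat (count_space UNIV) \<and>
      (\<forall>y\<in>S. i y \<le> n) \<and> 0 \<le> s \<and> (f_infinity f = \<infinity> \<longrightarrow> s = 0)"
    using u(1) unfolding outcomes_def by blast
  then obtain i s n where isn: "\<And>j. j \<in> {1..k} \<Longrightarrow> z j = outcome (i j) (s j) \<and>
      i j \<in> measurable Phat (count_space UNIV) \<and> (\<forall>y\<in>S. i j y \<le> n j) \<and> 0 \<le> s j \<and>
      (f_infinity f = \<infinity> \<longrightarrow> s j = 0)"
    by metis
  have "(\<Sum>j=1..k. u j *\<^sub>R outcome (i j) (s j)) = (\<Sum>j=1..k. u j *\<^sub>R z j)"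
    using isn by (intro sum.cong) auto
  then have eq: "(\<Sum>j=1..k. u j *\<^sub>R outcome (i j) (s j)) = (1, D, c, g)" using z by simp
  have comps:
    "(\<Sum>j=1..k. u j * ((\<integral>y. ratio (i j y) \<partial>Phat) + s j)) = 1"
    "(\<Sum>j=1..k. u j * ((\<integral>y. div_cost (i j y) \<partial>Phat) + recession * s j)) = D"
    "(\<Sum>j=1..k. u j * (\<integral>y. radius (i j y) \<partial>Phat)) = c"
    "(\<Sum>j=1..k. u j * ((\<integral>y. ratio (i j y) * gain (i j y) y \<partial>Phat) + s j * loss_sup S l x)) = g"
    using arg_cong[OF eq, of fst] arg_cong[OF eq, of "fst \<circ> snd"]
      arg_cong[OF eq, of "fst \<circ> snd \<circ> snd"] arg_cong[OF eq, of "snd \<circ> snd \<circ> snd"]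
    by (simp_all add: outcome_def fst_sum snd_sum)
  show ?thesis
    unfolding comps(4)[symmetric]
    using isn u comps assms(2,3)
    by (intro mixture_le_predictor[where n = n]) auto
qed

text \<open>This translates the linear functional found by separation in the outcome space into the
  pointwise dual value, leaving one term linear in \<open>s\<close>.\<close>

lemma outcome_lagrangian:
  assumes i: "i \<in> measurable Phat (count_space UNIV)" "\<And>y. y \<in> S \<Longrightarrow> i y \<le> n"
    and out: "outcome i s = (m, D, c, g)"
  shows "(\<integral>y. dual_value \<eta> lam \<gamma> (i y) y \<partial>Phat) + s * (loss_sup S l x - \<eta> - lam * recession)
    = g - \<eta> * m - lam * D - \<gamma> * c"
proof -
  have idx: "integrable Phat (\<lambda>y. c (i y) y)" if "\<And>m. integrable Phat (c m)" for c :: "nat \<Rightarrow> 'a \<Rightarrow> real"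
    by (rule integrable_compose_index[OF that i(1), of n]) (use i(2) space_Phat in simp)
  have [simp]: "integrable Phat (\<lambda>y. ratio (i y))" "integrable Phat (\<lambda>y. div_cost (i y))"
    "integrable Phat (\<lambda>y. radius (i y))" "integrable Phat (\<lambda>y. ratio (i y) * gain (i y) y)"
    using idx[of "\<lambda>m _. ratio m"] idx[of "\<lambda>m _. div_cost m"] idx[of "\<lambda>m _. radius m"]
      idx[of "\<lambda>m y. ratio m * gain m y"] gain_integrable by simp_all
  have "(\<integral>y. dual_value \<eta> lam \<gamma> (i y) y \<partial>Phat)
      = (\<integral>y. ratio (i y) * gain (i y) y - \<eta> * ratio (i y) - lam * div_cost (i y) - \<gamma> * radius (i y) \<partial>Phat)"
    by (simp add: dual_value_def algebra_simps)
  also have "\<dots> = (\<integral>y. ratio (i y) * gain (i y) y \<partial>Phat) - \<eta> * (\<integral>y. ratio (i y) \<partial>Phat)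
      - lam * (\<integral>y. div_cost (i y) \<partial>Phat) - \<gamma> * (\<integral>y. radius (i y) \<partial>Phat)"
    by simp
  finally show ?thesis
    using out by (auto simp: outcome_def algebra_simps)
qed

lemma constant_outcome:
  assumes "t \<in> \<rat>" "0 < t"
  obtains D g where "(t, D, 0, g) \<in> outcomes" "t = 1 \<Longrightarrow> D = 0"
proof -
  obtain m where m: "radius m = 0" "ratio m = t" using enumerated[OF \<Delta>_zero assms] by blast
  have "outcome (\<lambda>_. m) 0 \<in> outcomes" unfolding outcomes_def by fastforce
  moreover have "outcome (\<lambda>_. m) 0 = (t, div_cost m, 0, \<integral>y. t * gain m y \<partial>Phat)"
    using m by (simp add: outcome_def Phat.prob_space)
  moreover have "t = 1 \<Longrightarrow> div_cost m = 0"
    using m f by (simp add: div_cost_def divergence_generator_def)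
  ultimately show thesis using that by metis
qed

lemma predictor_real:
  assumes "0 \<le> r" "0 \<le> \<epsilon>"
  obtains v where "predictor S f d l r \<epsilon> x Phat = ereal v"
proof -
  obtain D g where "(1, D, 0, g) \<in> outcomes" "D = 0" using constant_outcome[of 1] by auto
  then have "ereal g \<le> predictor S f d l r \<epsilon> x Phat"
    using assms by (intro convex_hull_outcomes_le_predictor[of D 0 g] hull_inc) auto
  moreover have "predictor S f d l r \<epsilon> x Phat \<le> ereal (loss_sup S l x)"
    unfolding predictor_def
  proof (rule SUP_least, safe)
    fix P assume P: "P \<in> borel_probs S"
    then interpret P: prob_space P by (simp add: borel_probs_def)
    have sets: "sets P = sets BS" using P by (simp add: borel_probs_def)
    have "space P = S" using sets_eq_imp_space_eq[OF sets] by (simp add: space_restrict_space)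
    moreover have "l x \<in> borel_measurable P"
      using l_measurable measurable_cong_sets[OF sets refl] by blast
    ultimately have "(\<integral>y. l x y \<partial>P) \<le> (\<integral>y. loss_sup S l x \<partial>P)"
      using l_range
      by (intro integral_mono P.integrable_const_bound[of _ "loss_sup S l x"] AE_I2)
        (auto intro: order.trans)
    then show "ereal (\<integral>y. l x y \<partial>P) \<le> ereal (loss_sup S l x)" by (simp add: P.prob_space)
  qed
  ultimately show thesis using that by (cases "predictor S f d l r \<epsilon> x Phat") auto
qed

text \<open>Lagrange multipliers come from separating the outcomes of mixed strategies from the outcomes
  that would be feasible and beat the predictor.  Slater's condition, which rules out a vertical
  separating hyperplane, holds because staying put with likelihood ratio near 1 is strictly feasible
  up to the mass constraint, which can be violated in both directions.\<close>

theorem lagrange_multipliers: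
  assumes r: "0 < r" and \<epsilon>: "0 < \<epsilon>" and v: "predictor S f d l r \<epsilon> x Phat = ereal v"
  obtains \<eta> lam \<gamma> where "0 \<le> lam" "0 \<le> \<gamma>"
    "\<forall>m D c g. (m, D, c, g) \<in> outcomes \<longrightarrow>
       g - \<eta> * m - lam * D - \<gamma> * c \<le> v - \<eta> - lam * r - \<gamma> * \<epsilon>"
proof -
  \<comment> \<open>The last factor excludes \<open>v\<close>, which may be attained; a hull point
    in \<open>Z\<close> would beat the predictor.\<close>
  define Z where "Z = {1::real} \<times> {..r} \<times> {..\<epsilon>} \<times> {v<..}"
  have "convex Z" unfolding Z_def by (intro convex_Times) auto
  moreover have "Z \<noteq> {}" by (auto simp: Z_def intro!: gt_ex)
  moreover have "convex hull outcomes \<noteq> {}"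
    using constant_outcome[of 1] by auto
  moreover have "convex hull outcomes \<inter> Z = {}"
    using convex_hull_outcomes_le_predictor v by (force simp: Z_def)
  ultimately obtain w b where w: "w \<noteq> 0" "\<forall>z\<in>convex hull outcomes. inner w z \<le> b" "\<forall>z\<in>Z. b \<le> inner w z"
    using separating_hyperplane_sets[of "convex hull outcomes" Z] convex_convex_hull by blast
  obtain \<alpha> \<beta> \<kappa> \<omega> where w_eq: "w = (\<alpha>, \<beta>, \<kappa>, \<omega>)" by (metis prod.exhaust)
  have below: "\<alpha> * m + \<beta> * D + \<kappa> * c + \<omega> * g \<le> b" if "(m, D, c, g) \<in> outcomes" for m D c g
    using bspec[OF w(2) hull_inc[OF that]] by (simp add: w_eq algebra_simps)
  have above: "b \<le> \<alpha> + \<beta> * D + \<kappa> * c + \<omega> * g" if "D \<le> r" "c \<le> \<epsilon>" "v < g" for D c g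
    using bspec[OF w(3), of "(1, D, c, g)"] that by (simp add: Z_def w_eq algebra_simps)
  \<comment> \<open>\<open>Z\<close> is unbounded downwards in divergence and cost and upwards in
    gain, so a functional bounded below on \<open>Z\<close> has a definite sign in each of these
    directions.\<close>
  have sign: "0 \<le> p" if "\<And>t. 0 \<le> t \<Longrightarrow> q \<le> p * t" for p q :: real
  proof (rule ccontr)
    assume "\<not> 0 \<le> p"
    then have p: "p < 0" by simp
    have "q \<le> p * ((\<bar>q\<bar> + 1) / - p)" using p by (intro that) (simp add: divide_nonneg_neg)
    also have "\<dots> = - (\<bar>q\<bar> + 1)" using p by (simp add: field_simps)
    finally show False by linarith
  qed
  have "0 \<le> - \<beta>"
    using above[of "r - t" \<epsilon> "v + 1" for t]
    by (intro sign[of "b - (\<alpha> + \<beta> * r + \<kappa> * \<epsilon> + \<omega> * (v + 1))"]) (simp add: algebra_simps)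
  moreover have "0 \<le> - \<kappa>"
    using above[of r "\<epsilon> - t" "v + 1" for t]
    by (intro sign[of "b - (\<alpha> + \<beta> * r + \<kappa> * \<epsilon> + \<omega> * (v + 1))"]) (simp add: algebra_simps)
  moreover have "0 \<le> \<omega>"
    using above[of r \<epsilon> "v + 1 + t" for t]
    by (intro sign[of "b - (\<alpha> + \<beta> * r + \<kappa> * \<epsilon> + \<omega> * (v + 1))"]) (simp add: algebra_simps)
  ultimately have signs: "\<beta> \<le> 0" "\<kappa> \<le> 0" "0 \<le> \<omega>" by auto
  \<comment> \<open>The value \<open>v\<close> is reached only as a limit. The denominator
    \<open>\<omega> + 1\<close> keeps the error at most \<open>e\<close> and remains valid for
    \<open>\<omega> = 0\<close>.\<close>
  have top: "b \<le> \<alpha> + \<beta> * r + \<kappa> * \<epsilon> + \<omega> * v"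
  proof (rule field_le_epsilon)
    fix e :: real assume e: "0 < e"
    have "b \<le> \<alpha> + \<beta> * r + \<kappa> * \<epsilon> + \<omega> * (v + e / (\<omega> + 1))"
      using e signs by (intro above) auto
    also have "\<omega> * (v + e / (\<omega> + 1)) \<le> \<omega> * v + e"
      using e signs by (simp add: field_simps)
    finally show "b \<le> \<alpha> + \<beta> * r + \<kappa> * \<epsilon> + \<omega> * v + e" by simp
  qed
  \<comment> \<open>For \<open>\<omega> = 0\<close>, the outcome of mass 1 with no divergence and no
    cost yields \<open>\<beta> * r + \<kappa> * \<epsilon> \<ge> 0\<close>, so
    \<open>\<beta>\<close> and \<open>\<kappa>\<close> vanish. The ratios 2 and 1/2, on both sides
    of mass 1, then force \<open>\<alpha> = 0\<close>, contradicting
    \<open>w \<noteq> 0\<close>.\<close>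
  have "\<omega> \<noteq> 0"
  proof
    assume \<omega>: "\<omega> = 0"
    obtain D g where D: "(1, D, 0, g) \<in> outcomes" "D = 0" using constant_outcome[of 1] by auto
    have "\<alpha> \<le> \<alpha> + \<beta> * r + \<kappa> * \<epsilon>" using below[OF D(1)] top \<omega> D(2) by simp
    moreover have "\<beta> * r \<le> 0" "\<kappa> * \<epsilon> \<le> 0" using signs r \<epsilon> by (auto simp: mult_nonpos_nonneg)
    ultimately have "\<beta> * r = 0" "\<kappa> * \<epsilon> = 0" by linarith+
    then have zero: "\<beta> = 0" "\<kappa> = 0" using r \<epsilon> by auto
    have le: "\<alpha> * t \<le> \<alpha>" if t: "t \<in> \<rat>" "0 < t" for t
    proof -
      obtain D g where "(t, D, 0, g) \<in> outcomes" using constant_outcome[OF t] by blast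
      from below[OF this] show ?thesis using top \<omega> zero by simp
    qed
    have "\<alpha> = 0" using le[of 2] le[of "1/2"] by simp
    then show False using w(1) \<omega> zero by (simp add: w_eq zero_prod_def)
  qed
  then have \<omega>: "0 < \<omega>" using signs by simp
  show thesis
  proof (rule that[of "- \<beta> / \<omega>" "- \<kappa> / \<omega>" "- \<alpha> / \<omega>"]; (intro allI impI)?)
    fix m D c g assume out: "(m, D, c, g) \<in> outcomes"
    have "\<alpha> * m + \<beta> * D + \<kappa> * c + \<omega> * g \<le> \<alpha> + \<beta> * r + \<kappa> * \<epsilon> + \<omega> * v"
      by (rule order_trans[OF below[OF out] top])
    then have "(\<alpha> * m + \<beta> * D + \<kappa> * c + \<omega> * g) / \<omega> \<le> (\<alpha> + \<beta> * r + \<kappa> * \<epsilon> + \<omega> * v) / \<omega>"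
      using \<omega> by (intro divide_right_mono) auto
    then show "g - (- \<alpha> / \<omega>) * m - (- \<beta> / \<omega>) * D - (- \<kappa> / \<omega>) * c
        \<le> v - (- \<alpha> / \<omega>) - (- \<beta> / \<omega>) * r - (- \<kappa> / \<omega>) * \<epsilon>"
      using \<omega> by (simp add: add_divide_distrib algebra_simps)
  qed (use signs \<omega> in \<open>auto simp: divide_nonpos_pos\<close>)
qed

text \<open>The multipliers are dual feasible, as unbounded singular mass would otherwise push the
  Lagrangian past \<open>V\<close>. Strategies with \<open>s = 0\<close> bound the finite maxima of
  dual values, and monotone convergence passes to the full integrand.\<close>

theorem dual_le_predictor:
  assumes r: "0 < r" and \<epsilon>: "0 < \<epsilon>"
  obtains \<eta> lam \<gamma> where "0 \<le> lam" "0 \<le> \<gamma>"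
    "f_infinity f = \<infinity> \<or> ereal (loss_sup S l x - \<eta>) \<le> f_infinity f * ereal lam"
    "eintegral Phat (dual_integrand \<eta> lam \<gamma>) + ereal (r * lam + \<eta> + \<epsilon> * \<gamma>)
       \<le> predictor S f d l r \<epsilon> x Phat"
proof -
  obtain v where v: "predictor S f d l r \<epsilon> x Phat = ereal v"
    using predictor_real[of r \<epsilon>] r \<epsilon> by auto
  obtain \<eta> lam \<gamma> where nonneg: "0 \<le> lam" "0 \<le> \<gamma>"
    and le: "\<forall>m D c g. (m, D, c, g) \<in> outcomes \<longrightarrow>
       g - \<eta> * m - lam * D - \<gamma> * c \<le> v - \<eta> - lam * r - \<gamma> * \<epsilon>"
    by (rule lagrange_multipliers[OF r \<epsilon> v])
  define V where "V = v - \<eta> - lam * r - \<gamma> * \<epsilon>"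
  have bound: "(\<integral>y. dual_value \<eta> lam \<gamma> (i y) y \<partial>Phat) + s * (loss_sup S l x - \<eta> - lam * recession) \<le> V"
    if i: "i \<in> measurable Phat (count_space UNIV)" "\<And>y. y \<in> S \<Longrightarrow> i y \<le> n"
      and s: "0 \<le> s" "f_infinity f = \<infinity> \<Longrightarrow> s = 0" for i n s
  proof -
    obtain m D c g where out: "outcome i s = (m, D, c, g)" by (metis prod.exhaust)
    have "(m, D, c, g) \<in> outcomes"
      unfolding out[symmetric] outcomes_def using i s by blast
    from le[rule_format, OF this] outcome_lagrangian[OF i out, of \<eta> lam \<gamma>]
    show ?thesis unfolding V_def by simp
  qed
  have feas: "ereal (loss_sup S l x - \<eta>) \<le> f_infinity f * ereal lam" if fin: "f_infinity f \<noteq> \<infinity>"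
  proof -
    obtain a b :: "nat \<Rightarrow> real" where "f_infinity f = (SUP n. ereal (a n))"
      using generator_minorants[OF f] by blast
    then have "ereal (a 0) \<le> f_infinity f" by (auto intro: SUP_upper)
    then have rec: "f_infinity f = ereal recession"
      using fin by (cases "f_infinity f") (auto simp: recession_def)
    define p where "p = loss_sup S l x - \<eta> - lam * recession"
    define c0 where "c0 = (\<integral>y. dual_value \<eta> lam \<gamma> 0 y \<partial>Phat)"
    have *: "c0 + s * p \<le> V" if "0 \<le> s" for s
      using bound[of "\<lambda>_. 0" 0 s] that fin by (simp add: c0_def p_def)
    have "p \<le> 0"
    proof (rule ccontr)
      assume "\<not> p \<le> 0"
      then have "0 < p" by simp
      \<comment> \<open>This amount of singular mass raises the left side to
        \<open>c0 + \<bar>V - c0\<bar> + 1\<close>, which exceeds \<open>V\<close>.\<close>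
      then show False using *[of "(\<bar>V - c0\<bar> + 1) / p"] by simp
    qed
    then show ?thesis by (simp add: rec p_def mult.commute)
  qed
  have "eintegral Phat (dual_integrand \<eta> lam \<gamma>) \<le> ereal V"
  proof (rule eintegral_SUP_le)
    define G where "G n y = Max ((\<lambda>m. dual_value \<eta> lam \<gamma> m y) ` {..n})" for n y
    have G: "integrable Phat (G n) \<and> (\<integral>y. G n y \<partial>Phat) \<le> V" for n
    proof -
      obtain I where I: "I \<in> measurable Phat (count_space UNIV)" "\<And>y. I y \<le> n"
        and max: "\<And>y m. m \<le> n \<Longrightarrow> dual_value \<eta> lam \<gamma> m y \<le> dual_value \<eta> lam \<gamma> (I y) y"
        using measurable_argmax_index[of "dual_value \<eta> lam \<gamma>" Phat n,
            OF borel_measurable_integrable[OF dual_value_integrable]] by blast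
      have "G n = (\<lambda>y. dual_value \<eta> lam \<gamma> (I y) y)"
        unfolding G_def using max I(2) by (intro ext Max_eqI) auto
      then show ?thesis
        using integrable_compose_index[of Phat "dual_value \<eta> lam \<gamma>", OF dual_value_integrable I(1)]
          I(2) bound[OF I(1), of n 0] by auto
    qed
    show "integrable Phat (G n)" "(\<integral>y. G n y \<partial>Phat) \<le> V" for n using G by auto
    show "G m y \<le> G n y" if "m \<le> n" for m n y
      unfolding G_def using that by (intro Max_mono) auto
    show "dual_integrand \<eta> lam \<gamma> y = (SUP n. ereal (G n y))" for y
      unfolding dual_integrand_eq_SUP[OF nonneg(1)]
    proof (rule SUP_eq)
      fix n
      show "\<exists>m\<in>UNIV. ereal (dual_value \<eta> lam \<gamma> n y) \<le> ereal (G m y)"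
        by (intro bexI[of _ n]) (auto simp: G_def)
      have "G n y \<in> (\<lambda>m. dual_value \<eta> lam \<gamma> m y) ` {..n}" unfolding G_def by (intro Max_in) auto
      then show "\<exists>m\<in>UNIV. ereal (G n y) \<le> ereal (dual_value \<eta> lam \<gamma> m y)" by auto
    qed
  qed
  then have "eintegral Phat (dual_integrand \<eta> lam \<gamma>) + ereal (r * lam + \<eta> + \<epsilon> * \<gamma>)
      \<le> ereal V + ereal (r * lam + \<eta> + \<epsilon> * \<gamma>)"
    by (rule add_right_mono)
  also have "\<dots> = ereal v" by (simp add: V_def algebra_simps)
  finally show thesis using that[OF nonneg] feas v by metis
qed

end

section \<open>The grid\<close>

lemma delta_grid_finite: "finite (delta_grid S \<epsilon> K)"
proof -
  have "delta_grid S \<epsilon> K = (\<lambda>k. \<epsilon> * real k / real K) ` {..K} \<union>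
      (\<lambda>k. \<epsilon> * (diameter S / \<epsilon>) powr (real k / real K)) ` {..K}"
    by (auto simp: delta_grid_def)
  then show ?thesis by simp
qed

text \<open>Up to \<open>\<epsilon>\<close> the arithmetic points have spacing
  \<open>\<epsilon> / K\<close>, giving an additive error; above \<open>\<epsilon>\<close>
  consecutive geometric points differ by the factor \<open>\<rho>\<close>. The last geometric point
  is the diameter, hence the bound on \<open>t\<close>.\<close>

lemma delta_grid_round:
  assumes \<epsilon>: "0 < \<epsilon>" "\<epsilon> \<le> diameter S" and K: "1 \<le> K" and t: "0 \<le> t" "t \<le> diameter S"
  shows "\<exists>\<delta>\<in>delta_grid S \<epsilon> K. t \<le> \<delta> \<and>
    \<delta> \<le> (diameter S / \<epsilon>) powr (1 / real K) * t + \<epsilon> / real K"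
proof -
  define R where "R = diameter S / \<epsilon>"
  have R: "1 \<le> R" using \<epsilon> by (simp add: R_def)
  define \<rho> where "\<rho> = R powr (1 / real K)"
  have \<rho>: "1 \<le> \<rho>" using R K by (simp add: \<rho>_def ge_one_powr_ge_zero)
  have K0: "0 < real K" using K by simp
  show ?thesis
  proof (cases "t \<le> \<epsilon>")
    case True
    define k where "k = nat \<lceil>t * real K / \<epsilon>\<rceil>"
    have nonneg: "0 \<le> t * real K / \<epsilon>" using t \<epsilon> by simp
    have k: "t * real K / \<epsilon> \<le> real k" "real k \<le> t * real K / \<epsilon> + 1"
      using nonneg unfolding k_def by linarith+
    have "t * real K / \<epsilon> \<le> real K" using True \<epsilon> K0 by (simp add: pos_divide_le_eq mult.commute)
    then have "k \<le> K" unfolding k_def by (simp add: nat_le_iff ceiling_le_iff)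
    then have "\<epsilon> * real k / real K \<in> delta_grid S \<epsilon> K" by (auto simp: delta_grid_def)
    moreover have "t \<le> \<epsilon> * real k / real K"
      using k(1) \<epsilon> K0 by (simp add: field_simps)
    moreover have "\<epsilon> * real k / real K \<le> t + \<epsilon> / real K"
      using k(2) \<epsilon> K0 by (simp add: field_simps)
    moreover have "t \<le> \<rho> * t" using \<rho> t mult_right_mono[of 1 \<rho> t] by simp
    ultimately show ?thesis unfolding \<rho>_def R_def by (intro bexI conjI) auto
  next
    case False
    let ?g = "\<lambda>k::nat. \<epsilon> * R powr (real k / real K)"
    \<comment> \<open>The least index is positive because \<open>?g 0 = \<epsilon> < t\<close>, and
      its predecessor lies below \<open>t\<close>, so \<open>?g k\<close> is at most one factor
      \<open>\<rho>\<close> above \<open>t\<close>.\<close>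
    define k where "k = (LEAST k. t \<le> ?g k)"
    have gK: "t \<le> ?g K" using K0 R \<epsilon> t by (simp add: R_def)
    have k: "t \<le> ?g k" "k \<le> K"
      unfolding k_def by (rule LeastI[of "\<lambda>k. t \<le> ?g k", OF gK], rule Least_le, rule gK)
    have "k \<noteq> 0"
    proof
      assume "k = 0"
      then show False using k(1) R False by simp
    qed
    then obtain j where j: "k = Suc j" using not0_implies_Suc by blast
    have "?g j < t" using not_less_Least[of j "\<lambda>k. t \<le> ?g k"] by (simp add: k_def[symmetric] j)
    have "?g k = \<rho> * ?g j"
      by (simp add: j \<rho>_def powr_add[symmetric] add_divide_distrib add.commute mult_ac)
    also have "\<dots> \<le> \<rho> * t" using \<open>?g j < t\<close> \<rho> by (intro mult_left_mono) auto
    also have "\<dots> \<le> \<rho> * t + \<epsilon> / real K" using \<epsilon> by simp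
    finally have "?g k \<le> \<rho> * t + \<epsilon> / real K" .
    moreover have "?g k \<in> delta_grid S \<epsilon> K" using k(2) by (auto simp: delta_grid_def R_def)
    ultimately show ?thesis using k(1) unfolding \<rho>_def R_def by blast
  qed
qed

text \<open>The second inequality is conditional because the grid ends at the diameter, so costs
  beyond it cannot be rounded up. It can fail otherwise: take two points at distance 1 and mutual
  cost 2, \<open>\<epsilon> = 1\<close>, \<open>f_infinity f = \<infinity>\<close>, and
  \<open>Phat\<close> concentrated at the point of loss 0, the other loss being 1. No grid radius
  reaches the other point, yet half of the mass can be moved there.\<close>

theorem proposition8p8:
  fixes S :: "(real ^ 'n) set" and X :: "(real ^ 'm) set"
    and f :: "real \<Rightarrow> ereal" and d :: "real ^ 'n \<Rightarrow> real ^ 'n \<Rightarrow> real"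
    and l :: "real ^ 'm \<Rightarrow> real ^ 'n \<Rightarrow> real"
    and x :: "real ^ 'm" and Phat :: "(real ^ 'n) measure"
    and r \<epsilon> :: real and K :: nat
  assumes "compact S"
    and "divergence_generator f"
    and "usc_on UNIV (f_conj f)"
    and "\<And>\<xi> \<xi>'. \<xi> \<in> S \<Longrightarrow> \<xi>' \<in> S \<Longrightarrow> 0 \<le> d \<xi> \<xi>'"
    and "lsc_on (S \<times> S) (\<lambda>(\<xi>, \<xi>'). d \<xi> \<xi>')"
    and "\<And>\<xi>. \<xi> \<in> S \<Longrightarrow> d \<xi> \<xi> = 0"
    and "\<And>y \<xi>. y \<in> X \<Longrightarrow> \<xi> \<in> S \<Longrightarrow> 0 \<le> l y \<xi> \<and> l y \<xi> \<le> loss_sup S l y"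
    and "\<And>y. y \<in> X \<Longrightarrow> usc_on S (l y)"
    and "K \<ge> 1" and "r > 0"
    and "x \<in> X" and "Phat \<in> borel_probs S"
    and "\<epsilon> \<in> {0<..diameter S}"
  shows "discretized_predictor S f d l r \<epsilon> K x Phat \<le> predictor S f d l r \<epsilon> x Phat \<and>
    ((\<forall>\<xi>\<in>S. \<forall>\<xi>'\<in>S. d \<xi> \<xi>' \<le> diameter S) \<longrightarrow>
      predictor S f d l r \<epsilon> x Phat
        \<le> ereal ((diameter S / \<epsilon>) powr (1 / real K) + 1 / real K)
            * discretized_predictor S f d l r \<epsilon> K x Phat)"
proof -
  have \<epsilon>: "0 < \<epsilon>" "\<epsilon> \<le> diameter S" using assms(13) by auto
  have zero: "0 \<in> delta_grid S \<epsilon> K" unfolding delta_grid_def by (auto intro!: exI[of _ 0])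
  have nonneg: "0 \<le> \<delta>" if "\<delta> \<in> delta_grid S \<epsilon> K" for \<delta>
    using that \<epsilon> by (auto simp: delta_grid_def)
  interpret grid_setting S f d l x Phat "delta_grid S \<epsilon> K"
    by unfold_locales (use assms delta_grid_finite zero nonneg in auto)
  let ?F = "{(\<eta>, lam, \<gamma>). 0 \<le> lam \<and> 0 \<le> \<gamma> \<and>
    (f_infinity f = \<infinity> \<or> ereal (loss_sup S l x - \<eta>) \<le> f_infinity f * ereal lam)}"
  have obj: "discretized_objective S f d l r \<epsilon> K x Phat \<eta> lam \<gamma>
      = eintegral Phat (dual_integrand \<eta> lam \<gamma>) + ereal (r * lam + \<eta> + \<epsilon> * \<gamma>)" for \<eta> lam \<gamma>
    by (simp add: discretized_objective_def dual_integrand_def[abs_def])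
  show ?thesis
  proof (intro conjI impI)
    obtain \<eta> lam \<gamma> where "0 \<le> lam" "0 \<le> \<gamma>"
      "f_infinity f = \<infinity> \<or> ereal (loss_sup S l x - \<eta>) \<le> f_infinity f * ereal lam"
      "eintegral Phat (dual_integrand \<eta> lam \<gamma>) + ereal (r * lam + \<eta> + \<epsilon> * \<gamma>)
        \<le> predictor S f d l r \<epsilon> x Phat"
      by (rule dual_le_predictor[OF assms(10) \<epsilon>(1)])
    then show "discretized_predictor S f d l r \<epsilon> K x Phat \<le> predictor S f d l r \<epsilon> x Phat"
      unfolding discretized_predictor_def by (intro INF_lower2[of "(\<eta>, lam, \<gamma>)"]) (auto simp: obj)
  next
    assume d_le: "\<forall>\<xi>\<in>S. \<forall>\<xi>'\<in>S. d \<xi> \<xi>' \<le> diameter S"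
    define \<rho> where "\<rho> = (diameter S / \<epsilon>) powr (1 / real K)"
    have \<rho>: "1 \<le> \<rho>" using \<epsilon> by (simp add: \<rho>_def ge_one_powr_ge_zero)
    have round: "\<exists>\<delta>\<in>delta_grid S \<epsilon> K. d y z \<le> \<delta> \<and> \<delta> \<le> \<rho> * d y z + \<epsilon> / real K"
      if "y \<in> S" "z \<in> S" for y z
      unfolding \<rho>_def using that d_le by (intro delta_grid_round \<epsilon> assms(9) d_nonneg) auto
    let ?C = "\<rho> + 1 / real K"
    have C: "0 < ?C" using \<rho> by (intro add_pos_nonneg) auto
    \<comment> \<open>Dividing by the positive constant reduces the claim to a bound for each
      feasible dual point and avoids multiplying an infimum of extended reals.\<close>
    have "predictor S f d l r \<epsilon> x Phat / ereal ?C \<le> discretized_predictor S f d l r \<epsilon> K x Phat"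
      unfolding discretized_predictor_def
    proof (rule INF_greatest, clarify)
      fix \<eta> lam \<gamma> :: real
      assume "0 \<le> lam" "0 \<le> \<gamma>"
        "f_infinity f = \<infinity> \<or> ereal (loss_sup S l x - \<eta>) \<le> f_infinity f * ereal lam"
      \<comment> \<open>With additive error \<open>\<epsilon> / K\<close> the factor
        \<open>\<rho> + \<beta> / \<epsilon>\<close> becomes \<open>?C\<close>.\<close>
      from predictor_le_dual[OF round \<epsilon>(1) less_imp_le[OF assms(10)] \<rho> _ this] \<epsilon>(1)
      show "predictor S f d l r \<epsilon> x Phat / ereal ?C
          \<le> discretized_objective S f d l r \<epsilon> K x Phat \<eta> lam \<gamma>"
        unfolding obj using C by (subst ereal_divide_le_pos) auto
    qed
    then show "predictor S f d l r \<epsilon> x Phat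
        \<le> ereal ((diameter S / \<epsilon>) powr (1 / real K) + 1 / real K)
            * discretized_predictor S f d l r \<epsilon> K x Phat"
      unfolding \<rho>_def[symmetric] using C by (subst (asm) ereal_divide_le_pos) auto
  qed
qed

end
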